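(* Let $\pi:M\to\mathbb{R}$ be a smooth fibred manifold with $\dim M=n+1$, and let $S$ be a semispray on $J^1\pi$. Then $S$ is a Lagrangian vector field if and only if there exists a non-degenerate, semi-basic $1$-form $\theta$ on $J^1\pi$ such that the Lie derivative $\mathcal{L}_S\theta$ is closed.
   Context: Everything is $C^\infty$. $\pi:M\to\mathbb{R}$ is a fibred manifold with $\dim M=n+1$, $J^1\pi$ is the first jet bundle of $\pi$, and $\pi_{10}:J^1\pi\to M$, $\pi_{10}(j^1_t\gamma)=\gamma(t)$. Coordinates $(t,x^i)$ on $M$ ($t$ the global coordinate of $\mathbb{R}$, $x^i$ the fibre coordinates, $1\le i\le n$) induce coordinates $(t,x^i,y^i)$ on $J^1\pi$. Put $\delta x^i=dx^i-y^i\,dt$. Vertical vectors are those in $\operatorname{Ker}D\pi_{10}$, spanned by $\partial/\partial y^i$. The vertical endomorphism is the $(1,1)$-tensor field $J=\frac{\partial}{\partial y^i}\otimes\delta x^i$. A semispray is a globally defined vector field $S$ on $J^1\pi$ with $J(S)=0$ and $dt(S)=1$; locally $S=\frac{\partial}{\partial t}+y^i\frac{\partial}{\partial x^i}-2G^i(t,x,y)\frac{\partial}{\partial y^i}$. A $1$-form $\theta$ on $J^1\pi$ is semi-basic if it vanishes on vertical vectors, i.e. locally $\theta=\theta_0\,dt+\theta_i\,\delta x^i$ with $\theta_0,\theta_i$ functions of $(t,x,y)$. A semi-basic $1$-form $\theta$ on $J^1\pi$ is non-degenerate if the $2$-form $d\theta+i_Sd\theta\wedge dt$ has rank $2n$ on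 $J^1\pi$. A Lagrangian function is a smooth function $L$ on $J^1\pi$ (possibly only locally defined); its Poincaré–Cartan $1$-form is $\theta_L=L\,dt+d_JL$, where $d_JL=dL\circ J=\frac{\partial L}{\partial y^i}\delta x^i$. $L$ is regular if $d\theta_L$ has maximal rank $2n$. The semispray $S$ is called a Lagrangian vector field if there exists a (locally defined) regular Lagrangian $L$ such that $\mathcal{L}_S\theta_L=dL$.
   Formalization: Since local Lagrangians near each point need not yield a global form, the equivalence is stated with the form local as the Lagrangian is; a global form on the jet bundle still implies Lagrangian, and a Lagrangian on any open set (also the whole bundle) yields a form on that same set. *)

theory Defs
  imports "HOL-Analysis.Analysis"
begin

section \<open>Smooth manifolds, tangent vectors and forms\<close>

primrec Ck_on :: "nat \<Rightarrow> 'a::real_normed_vector set \<Rightarrow> ('a \<Rightarrow> 'b::real_normed_vector) \<Rightarrow> bool" where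
  "Ck_on 0 U f \<longleftrightarrow> continuous_on U f"
| "Ck_on (Suc k) U f \<longleftrightarrow> (\<forall>x\<in>U. f differentiable (at x)) \<and>
     (\<forall>v. Ck_on k U (\<lambda>x. frechet_derivative f (at x) v))"

text \<open>Only used for open \<open>U\<close>.\<close>
definition smooth_on :: "'a::real_normed_vector set \<Rightarrow> ('a \<Rightarrow> 'b::real_normed_vector) \<Rightarrow> bool" where
  "smooth_on U f \<longleftrightarrow> (\<forall>k. Ck_on k U f)"

text \<open>A chart is a domain together with a coordinate map that matters only on this domain. A
  manifold is given by an atlas; its underlying set is the union of the chart domains.\<close>

type_synonym ('p, 'e) chart = "'p set \<times> ('p \<Rightarrow> 'e)"
type_synonym ('p, 'e) atlas = "('p, 'e) chart set"

definition chart_inv :: "('p, 'e) chart \<Rightarrow> 'e \<Rightarrow> 'p" where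
  "chart_inv c = inv_into (fst c) (snd c)"

definition points :: "('p, 'e) atlas \<Rightarrow> 'p set" where
  "points A = \<Union> (fst ` A)"

definition is_chart :: "('p, 'e::euclidean_space) chart \<Rightarrow> bool" where
  "is_chart c \<longleftrightarrow> inj_on (snd c) (fst c) \<and> open (snd c ` fst c)"

definition compatible :: "('p, 'e::euclidean_space) chart \<Rightarrow> ('p, 'e) chart \<Rightarrow> bool" where
  "compatible c d \<longleftrightarrow>
     open (snd c ` (fst c \<inter> fst d)) \<and> open (snd d ` (fst c \<inter> fst d)) \<and>
     smooth_on (snd c ` (fst c \<inter> fst d)) (snd d \<circ> chart_inv c) \<and>
     smooth_on (snd d ` (fst c \<inter> fst d)) (snd c \<circ> chart_inv d)"

definition manifold_topology :: "('p, 'e::euclidean_space) atlas \<Rightarrow> 'p topology" where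
  "manifold_topology A = topology_generated_by {fst c \<inter> snd c -` V | c V. c \<in> A \<and> open V}"

definition smooth_manifold :: "('p, 'e::euclidean_space) atlas \<Rightarrow> bool" where
  "smooth_manifold A \<longleftrightarrow>
     (\<forall>c\<in>A. is_chart c) \<and> (\<forall>c\<in>A. \<forall>d\<in>A. compatible c d) \<and>
     Hausdorff_space (manifold_topology A) \<and> second_countable (manifold_topology A)"

definition maximal_atlas :: "('p, 'e::euclidean_space) atlas \<Rightarrow> ('p, 'e) atlas" where
  "maximal_atlas A = {c. is_chart c \<and> fst c \<subseteq> points A \<and> (\<forall>d\<in>A. compatible c d)}"

definition smooth_fun :: "('p, 'e::euclidean_space) atlas \<Rightarrow> 'p set \<Rightarrow> ('p \<Rightarrow> real) \<Rightarrow> bool" where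
  "smooth_fun A W f \<longleftrightarrow> (\<forall>c\<in>A. smooth_on (snd c ` (W \<inter> fst c)) (f \<circ> chart_inv c))"

definition smooth_near :: "('p, 'e::euclidean_space) atlas \<Rightarrow> 'p \<Rightarrow> ('p \<Rightarrow> real) \<Rightarrow> bool" where
  "smooth_near A p f \<longleftrightarrow> (\<exists>W. openin (manifold_topology A) W \<and> p \<in> W \<and> smooth_fun A W f)"

text \<open>A tangent vector at \<open>p\<close> is a directional derivative acting on the functions that are smooth
  near \<open>p\<close>; all other functions are mapped to \<open>0\<close>. The vector with components \<open>u\<close> in the chart
  \<open>c\<close> is \<open>tangent A c p u\<close>; so \<open>tangent A c p b\<close>, for a basis vector \<open>b\<close>, is the coordinate
  vector field of \<open>c\<close> at \<open>p\<close>.\<close>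

type_synonym 'p tvec = "('p \<Rightarrow> real) \<Rightarrow> real"

definition tangent :: "('p, 'e::euclidean_space) atlas \<Rightarrow> ('p, 'e) chart \<Rightarrow> 'p \<Rightarrow> 'e \<Rightarrow> 'p tvec" where
  "tangent A c p u = (\<lambda>f. if smooth_near A p f
     then frechet_derivative (f \<circ> chart_inv c) (at (snd c p)) u else 0)"

definition tangent_space :: "('p, 'e::euclidean_space) atlas \<Rightarrow> 'p \<Rightarrow> 'p tvec set" where
  "tangent_space A p = {tangent A c p u | c u. c \<in> A \<and> p \<in> fst c}"

definition components :: "('p, 'e::euclidean_space) chart \<Rightarrow> 'p tvec \<Rightarrow> 'e" where
  "components c v = (\<Sum>b\<in>Basis. v (\<lambda>q. snd c q \<bullet> b) *\<^sub>R b)"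

text \<open>The tangent map of \<open>F\<close> at \<open>p\<close>; the atlas \<open>B\<close> is that of the target manifold.\<close>
definition push :: "('q, 'e::euclidean_space) atlas \<Rightarrow> ('p \<Rightarrow> 'q) \<Rightarrow> 'p \<Rightarrow> 'p tvec \<Rightarrow> 'q tvec" where
  "push B F p v = (\<lambda>f. if smooth_near B (F p) f then v (f \<circ> F) else 0)"

definition vector_field ::
    "('p, 'e::euclidean_space) atlas \<Rightarrow> 'p set \<Rightarrow> ('p \<Rightarrow> 'p tvec) \<Rightarrow> bool" where
  "vector_field A W X \<longleftrightarrow> (\<forall>p\<in>W. X p \<in> tangent_space A p) \<and>
     (\<forall>c\<in>A. smooth_on (snd c ` (W \<inter> fst c)) (\<lambda>z. components c (X (chart_inv c z))))"

type_synonym 'p form1 = "'p \<Rightarrow> 'p tvec \<Rightarrow> real"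
type_synonym 'p form2 = "'p \<Rightarrow> 'p tvec \<Rightarrow> 'p tvec \<Rightarrow> real"

text \<open>The expression of a 1-form in a chart.\<close>
definition in_chart ::
    "('p, 'e::euclidean_space) atlas \<Rightarrow> ('p, 'e) chart \<Rightarrow> 'p form1 \<Rightarrow> 'e \<Rightarrow> 'e \<Rightarrow> real" where
  "in_chart A c \<theta> z u = \<theta> (chart_inv c z) (tangent A c (chart_inv c z) u)"

definition one_form :: "('p, 'e::euclidean_space) atlas \<Rightarrow> 'p set \<Rightarrow> 'p form1 \<Rightarrow> bool" where
  "one_form A W \<theta> \<longleftrightarrow> (\<forall>c\<in>A.
     (\<forall>z \<in> snd c ` (W \<inter> fst c). linear (in_chart A c \<theta> z)) \<and>
     (\<forall>u. smooth_on (snd c ` (W \<inter> fst c)) (\<lambda>z. in_chart A c \<theta> z u)))"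

text \<open>Some chart around \<open>p\<close>. It is used to write down coordinate formulas whose value does not
  depend on the chart.\<close>
definition chart_at :: "('p, 'e::euclidean_space) atlas \<Rightarrow> 'p \<Rightarrow> ('p, 'e) chart" where
  "chart_at A p = (SOME c. c \<in> A \<and> p \<in> fst c)"

definition differential :: "('p \<Rightarrow> real) \<Rightarrow> 'p form1" where
  "differential f = (\<lambda>p v. v f)"

text \<open>In coordinates \<open>d\<theta>(\<partial>\<^sub>a, \<partial>\<^sub>b) = \<partial>\<^sub>a \<theta>\<^sub>b - \<partial>\<^sub>b \<theta>\<^sub>a\<close>.\<close>
definition ext_deriv :: "('p, 'e::euclidean_space) atlas \<Rightarrow> 'p form1 \<Rightarrow> 'p form2" where
  "ext_deriv A \<theta> = (\<lambda>p v w.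
     let c = chart_at A p; v' = components c v; w' = components c w in
       frechet_derivative (\<lambda>z. in_chart A c \<theta> z w') (at (snd c p)) v' -
       frechet_derivative (\<lambda>z. in_chart A c \<theta> z v') (at (snd c p)) w')"

definition closed_form :: "('p, 'e::euclidean_space) atlas \<Rightarrow> 'p set \<Rightarrow> 'p form1 \<Rightarrow> bool" where
  "closed_form A W \<theta> \<longleftrightarrow>
     (\<forall>p\<in>W. \<forall>v\<in>tangent_space A p. \<forall>w\<in>tangent_space A p. ext_deriv A \<theta> p v w = 0)"

definition interior1 :: "('p \<Rightarrow> 'p tvec) \<Rightarrow> 'p form1 \<Rightarrow> 'p \<Rightarrow> real" where
  "interior1 X \<theta> = (\<lambda>p. \<theta> p (X p))"

definition interior2 :: "('p \<Rightarrow> 'p tvec) \<Rightarrow> 'p form2 \<Rightarrow> 'p form1" where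
  "interior2 X \<omega> = (\<lambda>p v. \<omega> p (X p) v)"

definition wedge :: "'p form1 \<Rightarrow> 'p form1 \<Rightarrow> 'p form2" where
  "wedge \<alpha> \<beta> = (\<lambda>p v w. \<alpha> p v * \<beta> p w - \<alpha> p w * \<beta> p v)"

text \<open>The Lie derivative \<open>L\<^sub>X = i\<^sub>X d + d i\<^sub>X\<close> on 1-forms.\<close>
definition lie_deriv ::
    "('p, 'e::euclidean_space) atlas \<Rightarrow> ('p \<Rightarrow> 'p tvec) \<Rightarrow> 'p form1 \<Rightarrow> 'p form1" where
  "lie_deriv A X \<theta> =
     (\<lambda>p v. interior2 X (ext_deriv A \<theta>) p v + differential (interior1 X \<theta>) p v)"

text \<open>The rank of a 2-form at \<open>p\<close>, i.e. the rank of the linear map \<open>v \<mapsto> i\<^sub>v \<omega>\<close> from tangent to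
  cotangent vectors, where covectors are represented by their components in a chart.\<close>
definition rank2 :: "('p, 'e::euclidean_space) atlas \<Rightarrow> 'p \<Rightarrow> 'p form2 \<Rightarrow> nat" where
  "rank2 A p \<omega> = (let c = chart_at A p in
     dim (range (\<lambda>u. \<Sum>b\<in>Basis. \<omega> p (tangent A c p u) (tangent A c p b) *\<^sub>R b)))"


section \<open>Fibred manifolds over the real line and their first jet bundle\<close>

text \<open>Manifolds of dimension \<open>n + 1\<close> are modelled on \<open>real \<times> (real ^ 'n)\<close>, where \<open>n = CARD('n)\<close>.
  The charts of the given atlas need not be adapted to the fibration.\<close>

definition fibred_manifold :: "('m, real \<times> (real ^ 'n)) atlas \<Rightarrow> ('m \<Rightarrow> real) \<Rightarrow> bool" where
  "fibred_manifold A \<pi> \<longleftrightarrow> smooth_manifold A \<and> \<pi> ` points A = UNIV \<and>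
     smooth_fun A (points A) \<pi> \<and>
     (\<forall>c\<in>A. \<forall>z \<in> snd c ` fst c. surj (frechet_derivative (\<pi> \<circ> chart_inv c) (at z)))"

text \<open>Adapted charts, with coordinates \<open>(t, x)\<close>.\<close>
definition fibred_charts ::
    "('m, real \<times> (real ^ 'n)) atlas \<Rightarrow> ('m \<Rightarrow> real) \<Rightarrow> ('m, real \<times> (real ^ 'n)) atlas" where
  "fibred_charts A \<pi> = {c \<in> maximal_atlas A. \<forall>p \<in> fst c. fst (snd c p) = \<pi> p}"

definition smooth_curve_on :: "('p, 'e::euclidean_space) atlas \<Rightarrow> real set \<Rightarrow> (real \<Rightarrow> 'p) \<Rightarrow> bool" where
  "smooth_curve_on A I \<gamma> \<longleftrightarrow> \<gamma> ` I \<subseteq> points A \<and>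
     (\<forall>c\<in>A. \<forall>s\<in>I. \<gamma> s \<in> fst c \<longrightarrow>
        (\<exists>N. open N \<and> s \<in> N \<and> N \<subseteq> I \<and> \<gamma> ` N \<subseteq> fst c \<and> smooth_on N (snd c \<circ> \<gamma>)))"

definition local_section ::
    "('m, real \<times> (real ^ 'n)) atlas \<Rightarrow> ('m \<Rightarrow> real) \<Rightarrow> real \<Rightarrow> (real \<Rightarrow> 'm) \<Rightarrow> bool" where
  "local_section A \<pi> t \<gamma> \<longleftrightarrow>
     (\<exists>I. open I \<and> t \<in> I \<and> smooth_curve_on A I \<gamma> \<and> (\<forall>s\<in>I. \<pi> (\<gamma> s) = s))"

text \<open>The 1-jet of \<open>\<gamma>\<close> at \<open>t\<close>: the pair of \<open>t\<close> and the class of all sections near \<open>t\<close> that have the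
  same value and the same first derivative at \<open>t\<close>.\<close>

type_synonym 'm jet = "real \<times> (real \<Rightarrow> 'm) set"

definition jet ::
    "('m, real \<times> (real ^ 'n)) atlas \<Rightarrow> ('m \<Rightarrow> real) \<Rightarrow> real \<Rightarrow> (real \<Rightarrow> 'm) \<Rightarrow> 'm jet" where
  "jet A \<pi> t \<gamma> = (t, {\<sigma>. local_section A \<pi> t \<sigma> \<and> \<sigma> t = \<gamma> t \<and>
     (\<forall>c\<in>A. \<gamma> t \<in> fst c \<longrightarrow>
        vector_derivative (snd c \<circ> \<sigma>) (at t) = vector_derivative (snd c \<circ> \<gamma>) (at t))})"

definition J1 :: "('m, real \<times> (real ^ 'n)) atlas \<Rightarrow> ('m \<Rightarrow> real) \<Rightarrow> 'm jet set" where
  "J1 A \<pi> = {jet A \<pi> t \<gamma> | t \<gamma>. local_section A \<pi> t \<gamma>}"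

definition jet_rep :: "'m jet \<Rightarrow> real \<Rightarrow> 'm" where
  "jet_rep j = (SOME \<gamma>. \<gamma> \<in> snd j)"

definition pi10 :: "'m jet \<Rightarrow> 'm" where
  "pi10 j = jet_rep j (fst j)"

text \<open>The coordinates \<open>(t, x, y)\<close> on the jet bundle induced by an adapted chart.\<close>
definition jet_chart ::
    "('m, real \<times> (real ^ 'n)) atlas \<Rightarrow> ('m \<Rightarrow> real) \<Rightarrow> ('m, real \<times> (real ^ 'n)) chart \<Rightarrow>
     ('m jet, real \<times> (real ^ 'n) \<times> (real ^ 'n)) chart" where
  "jet_chart A \<pi> c = ({j \<in> J1 A \<pi>. pi10 j \<in> fst c},
     (\<lambda>j. (fst j, snd (snd c (pi10 j)),
           vector_derivative (\<lambda>s. snd (snd c (jet_rep j s))) (at (fst j)))))"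

definition jet_atlas ::
    "('m, real \<times> (real ^ 'n)) atlas \<Rightarrow> ('m \<Rightarrow> real) \<Rightarrow>
     ('m jet, real \<times> (real ^ 'n) \<times> (real ^ 'n)) atlas" where
  "jet_atlas A \<pi> = jet_chart A \<pi> ` fibred_charts A \<pi>"

definition dt :: "'m jet form1" where
  "dt = differential fst"

definition vertical :: "('m, real \<times> (real ^ 'n)) atlas \<Rightarrow> 'm jet \<Rightarrow> 'm jet tvec \<Rightarrow> bool" where
  "vertical A j v \<longleftrightarrow> push A pi10 j v = (\<lambda>f. 0)"

text \<open>\<open>J = \<partial>/\<partial>y\<^sup>i \<otimes> \<delta>x\<^sup>i\<close> with \<open>\<delta>x\<^sup>i = dx\<^sup>i - y\<^sup>i dt\<close>.\<close>
definition vertical_endo ::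
    "('m, real \<times> (real ^ 'n)) atlas \<Rightarrow> ('m \<Rightarrow> real) \<Rightarrow> 'm jet \<Rightarrow> 'm jet tvec \<Rightarrow> 'm jet tvec" where
  "vertical_endo A \<pi> j v =
     (let c = chart_at (jet_atlas A \<pi>) j; (t, x, y) = snd c j; (\<tau>, \<xi>, \<eta>) = components c v
      in tangent (jet_atlas A \<pi>) c j (0, 0, \<xi> - \<tau> *\<^sub>R y))"

definition semispray ::
    "('m, real \<times> (real ^ 'n)) atlas \<Rightarrow> ('m \<Rightarrow> real) \<Rightarrow> ('m jet \<Rightarrow> 'm jet tvec) \<Rightarrow> bool" where
  "semispray A \<pi> S \<longleftrightarrow> vector_field (jet_atlas A \<pi>) (J1 A \<pi>) S \<and>
     (\<forall>j \<in> J1 A \<pi>. vertical_endo A \<pi> j (S j) = (\<lambda>f. 0) \<and> dt j (S j) = 1)"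


section \<open>Semi-basic forms and Lagrangians on open subsets of the jet bundle\<close>

definition semi_basic ::
    "('m, real \<times> (real ^ 'n)) atlas \<Rightarrow> ('m \<Rightarrow> real) \<Rightarrow> 'm jet set \<Rightarrow> 'm jet form1 \<Rightarrow> bool" where
  "semi_basic A \<pi> W \<theta> \<longleftrightarrow> one_form (jet_atlas A \<pi>) W \<theta> \<and>
     (\<forall>j\<in>W. \<forall>v \<in> tangent_space (jet_atlas A \<pi>) j. vertical A j v \<longrightarrow> \<theta> j v = 0)"

definition nondegenerate ::
    "('m, real \<times> (real ^ 'n)) atlas \<Rightarrow> ('m \<Rightarrow> real) \<Rightarrow> ('m jet \<Rightarrow> 'm jet tvec) \<Rightarrow>
     'm jet set \<Rightarrow> 'm jet form1 \<Rightarrow> bool" where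
  "nondegenerate A \<pi> S W \<theta> \<longleftrightarrow>
     (let B = jet_atlas A \<pi>; d\<theta> = ext_deriv B \<theta> in
      \<forall>j\<in>W. rank2 B j (\<lambda>p v w. d\<theta> p v w + wedge (interior2 S d\<theta>) dt p v w) = 2 * CARD('n))"

definition poincare_cartan ::
    "('m, real \<times> (real ^ 'n)) atlas \<Rightarrow> ('m \<Rightarrow> real) \<Rightarrow> ('m jet \<Rightarrow> real) \<Rightarrow> 'm jet form1" where
  "poincare_cartan A \<pi> L =
     (\<lambda>j v. L j * dt j v + differential L j (vertical_endo A \<pi> j v))"

definition regular_lagrangian ::
    "('m, real \<times> (real ^ 'n)) atlas \<Rightarrow> ('m \<Rightarrow> real) \<Rightarrow> 'm jet set \<Rightarrow> ('m jet \<Rightarrow> real) \<Rightarrow> bool" where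
  "regular_lagrangian A \<pi> W L \<longleftrightarrow> smooth_fun (jet_atlas A \<pi>) W L \<and>
     (\<forall>j\<in>W. rank2 (jet_atlas A \<pi>) j (ext_deriv (jet_atlas A \<pi>) (poincare_cartan A \<pi> L))
            = 2 * CARD('n))"

definition euler_lagrange_on ::
    "('m, real \<times> (real ^ 'n)) atlas \<Rightarrow> ('m \<Rightarrow> real) \<Rightarrow> ('m jet \<Rightarrow> 'm jet tvec) \<Rightarrow>
     'm jet set \<Rightarrow> ('m jet \<Rightarrow> real) \<Rightarrow> bool" where
  "euler_lagrange_on A \<pi> S W L \<longleftrightarrow>
     (\<forall>j\<in>W. \<forall>v \<in> tangent_space (jet_atlas A \<pi>) j.
        lie_deriv (jet_atlas A \<pi>) S (poincare_cartan A \<pi> L) j v = differential L j v)"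

abbreviation jet_open ::
    "('m, real \<times> (real ^ 'n)) atlas \<Rightarrow> ('m \<Rightarrow> real) \<Rightarrow> 'm jet set \<Rightarrow> bool" where
  "jet_open A \<pi> W \<equiv> openin (manifold_topology (jet_atlas A \<pi>)) W"

text \<open>The Lagrangian is only locally defined: there is one near each point of the jet bundle, and
  different ones need not agree where their domains overlap.\<close>
definition lagrangian_vector_field ::
    "('m, real \<times> (real ^ 'n)) atlas \<Rightarrow> ('m \<Rightarrow> real) \<Rightarrow> ('m jet \<Rightarrow> 'm jet tvec) \<Rightarrow> bool" where
  "lagrangian_vector_field A \<pi> S \<longleftrightarrow>
     (\<forall>j \<in> J1 A \<pi>. \<exists>W L. jet_open A \<pi> W \<and> j \<in> W \<and>
        regular_lagrangian A \<pi> W L \<and> euler_lagrange_on A \<pi> S W L)"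

end

theory Submission
  imports Defs
begin

text \<open>Let \<open>\<theta>\<close> be semi-basic with \<open>\<L>\<^sub>S \<theta>\<close> closed, and let \<open>L\<close> be a local potential of \<open>\<L>\<^sub>S \<theta>\<close>, which
  exists by the Poincare lemma. Evaluating \<open>\<L>\<^sub>S \<theta> = dL\<close> on the vertical fields gives
  \<open>\<theta>\<^sub>i = \<partial>L/\<partial>y\<^sup>i\<close>, so \<open>\<theta> = \<theta>\<^sub>L + g dt\<close> with \<open>g = \<theta>(S) - L\<close>; evaluating it on \<open>S\<close> gives
  \<open>S(g) = 0\<close>. Hence \<open>\<L>\<^sub>S \<theta>\<^sub>L = dL\<close>, and as \<open>i\<^sub>S d\<theta> = - dg\<close>, the 2-form
  \<open>d\<theta> + i\<^sub>S d\<theta> \<and> dt\<close> is \<open>d\<theta>\<^sub>L\<close>. Conversely \<open>\<theta> = \<theta>\<^sub>L\<close> works, because \<open>i\<^sub>S d\<theta>\<^sub>L = 0\<close>. The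
  charts of the jet atlas cover the jet bundle, because \<open>S\<close> takes its values in the tangent
  spaces of this atlas.\<close>

section \<open>Calculus of smooth functions\<close>

text \<open>The obstacle is that no chart is fixed in advance: tangent vectors are functionals that
  send every function not smooth near the point to 0, and \<open>ext_deriv\<close> and
  \<open>vertical_endo\<close> compute in a chart chosen separately at each point. Once their
  expressions are known in every chart, the argument lives on one open subset of the model space,
  where \<theta> acts as the inner product with a vector function \<open>a\<close> and S is a vector
  function \<open>\<sigma>\<close> of the form (1, y, ...). Cartan's formula becomes \<open>D a z
  (\<sigma> z) \<bullet> u + a z \<bullet> D \<sigma> z u\<close>. For vertical u = (0, 0, \<eta>)
  the first term vanishes, because \<theta> kills vertical vectors at every point, and the second is
  the x-part of \<open>a\<close> applied to \<eta>, because the x-part of \<open>\<sigma>\<close> is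
  y itself: this is where the semispray condition enters. S(g) = 0 comes from the antisymmetry of
  d\<theta>, and the term g dt costs nothing because its Lie derivative along S is S(g) dt, dt(S)
  being constant.\<close>

abbreviation D :: "('a::real_normed_vector \<Rightarrow> 'b::real_normed_vector) \<Rightarrow> 'a \<Rightarrow> 'a \<Rightarrow> 'b" where
  "D f x \<equiv> frechet_derivative f (at x)"

lemma D_eqI: "(f has_derivative f') (at x) \<Longrightarrow> D f x = f'"
  by (rule frechet_derivative_at[symmetric])

lemma has_D: "f differentiable (at x) \<Longrightarrow> (f has_derivative D f x) (at x)"
  by (rule iffD1[OF frechet_derivative_works])

lemma linear_D: "f differentiable (at x) \<Longrightarrow> linear (D f x)"
  by (rule linear_frechet_derivative)

lemma linear_basis_expansion:
  fixes h :: "'a::euclidean_space \<Rightarrow> 'b::real_vector"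
  assumes "linear h"
  shows "h v = (\<Sum>b\<in>Basis. (v \<bullet> b) *\<^sub>R h b)"
proof -
  have "h v = h (\<Sum>b\<in>Basis. (v \<bullet> b) *\<^sub>R b)"
    by (simp add: euclidean_representation)
  then show ?thesis
    using assms by (simp add: linear_sum linear_scale)
qed

lemma D_basis_expansion:
  fixes f :: "'a::euclidean_space \<Rightarrow> 'b::real_normed_vector"
  assumes "f differentiable (at x)"
  shows "D f x v = (\<Sum>b\<in>Basis. (v \<bullet> b) *\<^sub>R D f x b)"
  by (rule linear_basis_expansion[OF linear_D[OF assms]])

lemma D_cong:
  assumes "open U" "x \<in> U" "\<And>y. y \<in> U \<Longrightarrow> f y = g y" "f differentiable (at x)"
  shows "D f x = D g x"
  by (rule frechet_derivative_transform_within_open[OF assms(4,1,2,3)])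

lemma differentiable_cong:
  assumes "open U" "x \<in> U" "\<And>y. y \<in> U \<Longrightarrow> f y = g y" "f differentiable (at x)"
  shows "g differentiable (at x)"
  using has_derivative_transform_within_open[OF has_D[OF assms(4)] assms(1,2,3)]
  by (rule differentiableI)

lemma D_compose:
  assumes "f differentiable (at x)" "g differentiable (at (f x))"
  shows "D (\<lambda>y. g (f y)) x v = D g (f x) (D f x v)"
  using frechet_derivative_compose[OF assms] by (simp add: o_def fun_eq_iff)

lemma D_compose_linear:
  assumes "bounded_linear h" "f differentiable (at x)"
  shows "D (\<lambda>y. h (f y)) x v = h (D f x v)"
  using D_eqI[OF bounded_linear.has_derivative[OF assms(1) has_D[OF assms(2)]]] by simp

lemma D_add:
  assumes "f differentiable (at x)" "g differentiable (at x)"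
  shows "D (\<lambda>y. f y + g y) x v = D f x v + D g x v"
  using D_eqI[OF has_derivative_add[OF has_D[OF assms(1)] has_D[OF assms(2)]]] by simp

lemma D_diff:
  assumes "f differentiable (at x)" "g differentiable (at x)"
  shows "D (\<lambda>y. f y - g y) x v = D f x v - D g x v"
  using D_eqI[OF has_derivative_diff[OF has_D[OF assms(1)] has_D[OF assms(2)]]] by simp

lemma D_bilinear:
  assumes "bounded_bilinear h" "f differentiable (at x)" "g differentiable (at x)"
  shows "D (\<lambda>y. h (f y) (g y)) x v = h (f x) (D g x v) + h (D f x v) (g x)"
  using D_eqI[OF bounded_bilinear.FDERIV[OF assms(1) has_D[OF assms(2)] has_D[OF assms(3)]]]
  by simp

lemmas D_inner = D_bilinear[OF bounded_bilinear_inner]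

lemma differentiable_bilinear:
  assumes "bounded_bilinear h" "f differentiable (at x)" "g differentiable (at x)"
  shows "(\<lambda>y. h (f y) (g y)) differentiable (at x)"
  using bounded_bilinear.FDERIV[OF assms(1) has_D[OF assms(2)] has_D[OF assms(3)]]
  unfolding differentiable_def by blast

lemma differentiable_bounded_linear:
  assumes "bounded_linear h" "f differentiable (at x)"
  shows "(\<lambda>y. h (f y)) differentiable (at x)"
  using bounded_linear.has_derivative[OF assms(1) has_D[OF assms(2)]]
  unfolding differentiable_def by blast

section \<open>Closure properties of C^k and smooth functions\<close>

lemma Ck_on_cong:
  assumes "open U"
  shows "\<lbrakk>\<And>x. x \<in> U \<Longrightarrow> f x = g x; Ck_on k U f\<rbrakk> \<Longrightarrow> Ck_on k U g"
proof (induction k arbitrary: f g)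
  case 0
  then show ?case by (simp cong: continuous_on_cong)
next
  case (Suc k)
  have "g differentiable (at x)" if "x \<in> U" for x
    using differentiable_cong[OF assms that, of f g] Suc.prems that by auto
  moreover have "Ck_on k U (\<lambda>x. D g x v)" for v
    by (rule Suc.IH[of "\<lambda>x. D f x v"]) (use D_cong[OF assms, of _ f g] Suc.prems in auto)
  ultimately show ?case by simp
qed

lemma Ck_on_subset: "\<lbrakk>V \<subseteq> U; Ck_on k U f\<rbrakk> \<Longrightarrow> Ck_on k V f"
  by (induction k arbitrary: f) (auto intro: continuous_on_subset)

lemma Ck_on_SucD: "Ck_on (Suc k) U f \<Longrightarrow> Ck_on k U f"
proof (induction k arbitrary: f)
  case 0
  then show ?case
    by (auto intro!: continuous_at_imp_continuous_on differentiable_imp_continuous_within)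
qed auto

lemma Ck_on_local:
  "(\<And>x. x \<in> U \<Longrightarrow> \<exists>V. open V \<and> x \<in> V \<and> Ck_on k V f) \<Longrightarrow> Ck_on k U f"
proof (induction k arbitrary: f)
  case 0
  then show ?case
    by (auto intro!: continuous_at_imp_continuous_on simp: continuous_on_eq_continuous_at dest!: 0)
next
  case (Suc k)
  show ?case
    unfolding Ck_on.simps
  proof (intro conjI allI ballI)
    show "f differentiable (at x)" if "x \<in> U" for x
      using Suc.prems[OF that] by auto
    show "Ck_on k U (\<lambda>x. D f x v)" for v
    proof (rule Suc.IH)
      fix x assume "x \<in> U"
      with Suc.prems obtain V where "open V" "x \<in> V" "Ck_on (Suc k) V f" by blast
      then show "\<exists>V. open V \<and> x \<in> V \<and> Ck_on k V (\<lambda>x. D f x v)" by auto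
    qed
  qed
qed

lemma Ck_on_const: "Ck_on k U (\<lambda>x. c)"
  by (induction k arbitrary: c) auto

lemma Ck_on_add:
  assumes "open U"
  shows "\<lbrakk>Ck_on k U f; Ck_on k U g\<rbrakk> \<Longrightarrow> Ck_on k U (\<lambda>x. f x + g x)"
proof (induction k arbitrary: f g)
  case 0
  then show ?case by (auto intro: continuous_intros)
next
  case (Suc k)
  have "Ck_on k U (\<lambda>x. D (\<lambda>x. f x + g x) x v)" for v
    by (rule Ck_on_cong[OF assms, of "\<lambda>x. D f x v + D g x v"])
      (use Suc in \<open>auto simp: D_add\<close>)
  then show ?case
    using Suc.prems by (auto intro: differentiable_add)
qed

text \<open>One induction for multiplication, scaling and inner product. The product rule keeps
  undifferentiated factors, so the step needs them in class k as well, which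
  \<open>Ck_on_SucD\<close> supplies.\<close>

lemma Ck_on_bilinear:
  assumes "open U" "bounded_bilinear h"
  shows "\<lbrakk>Ck_on k U f; Ck_on k U g\<rbrakk> \<Longrightarrow> Ck_on k U (\<lambda>x. h (f x) (g x))"
proof (induction k arbitrary: f g)
  case 0
  then show ?case
    using bounded_bilinear.continuous_on[OF assms(2)] by auto
next
  case (Suc k)
  have "Ck_on k U (\<lambda>x. D (\<lambda>x. h (f x) (g x)) x v)" for v
  proof (rule Ck_on_cong[OF assms(1), of "\<lambda>x. h (f x) (D g x v) + h (D f x v) (g x)"])
    show "Ck_on k U (\<lambda>x. h (f x) (D g x v) + h (D f x v) (g x))"
      using Suc.prems Suc.prems[THEN Ck_on_SucD] by (intro Ck_on_add[OF assms(1)] Suc.IH) auto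
  qed (use Suc.prems in \<open>auto simp: D_bilinear[OF assms(2)]\<close>)
  then show ?case
    using Suc.prems by (auto intro: differentiable_bilinear[OF assms(2)])
qed

lemma Ck_on_bounded_linear:
  assumes "open U" "bounded_linear h"
  shows "Ck_on k U f \<Longrightarrow> Ck_on k U (\<lambda>x. h (f x))"
proof (induction k arbitrary: f)
  case 0
  then show ?case
    using bounded_linear.continuous_on[OF assms(2)] by auto
next
  case (Suc k)
  have "Ck_on k U (\<lambda>x. D (\<lambda>x. h (f x)) x v)" for v
    by (rule Ck_on_cong[OF assms(1), of "\<lambda>x. h (D f x v)"])
      (use Suc in \<open>auto simp: D_compose_linear[OF assms(2)]\<close>)
  then show ?case
    using Suc.prems by (auto intro: differentiable_bounded_linear[OF assms(2)])
qed

lemma Ck_on_ident: "open U \<Longrightarrow> Ck_on k U (\<lambda>x. x)"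
  by (cases k) (auto simp: Ck_on_const)

lemma Ck_on_sum:
  assumes "open U"
  shows "(\<And>i. i \<in> I \<Longrightarrow> Ck_on k U (f i)) \<Longrightarrow> Ck_on k U (\<lambda>x. \<Sum>i\<in>I. f i x)"
  by (induction I rule: infinite_finite_induct) (auto simp: Ck_on_const intro: Ck_on_add[OF assms])

text \<open>\<open>Ck_on\<close> controls derivatives in fixed directions only, whereas the chain
  rule applies \<open>D g (f x)\<close> to \<open>D f x v\<close>, which moves with x. Expanding
  this direction in the finite basis of the middle space leaves fixed directions, sums and products;
  hence the Euclidean type of \<open>'b\<close>.\<close>

lemma Ck_on_compose:
  fixes g :: "'b::euclidean_space \<Rightarrow> 'c::real_normed_vector"
  assumes "open U" "f ` U \<subseteq> V"
  shows "\<lbrakk>Ck_on k U f; Ck_on k V g\<rbrakk> \<Longrightarrow> Ck_on k U (\<lambda>x. g (f x))"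
proof (induction k arbitrary: g)
  case 0
  then show ?case
    using assms(2) continuous_on_compose2 by auto
next
  case (Suc k)
  have dif: "f differentiable (at x)" "g differentiable (at (f x))" if "x \<in> U" for x
    using Suc.prems assms that by auto
  have "Ck_on k U (\<lambda>x. D (\<lambda>x. g (f x)) x v)" for v
  proof (rule Ck_on_cong[OF assms(1), of "\<lambda>x. \<Sum>b\<in>Basis. (D f x v \<bullet> b) *\<^sub>R D g (f x) b"])
    show "Ck_on k U (\<lambda>x. \<Sum>b\<in>Basis. (D f x v \<bullet> b) *\<^sub>R D g (f x) b)"
    proof (intro Ck_on_sum[OF assms(1)] Ck_on_bilinear[OF assms(1) bounded_bilinear_scaleR])
      fix b :: 'b
      show "Ck_on k U (\<lambda>x. D f x v \<bullet> b)"
        using Suc.prems by (intro Ck_on_bounded_linear[OF assms(1) bounded_linear_inner_left]) auto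
      show "Ck_on k U (\<lambda>x. D g (f x) b)"
        by (rule Suc.IH[OF Ck_on_SucD[OF Suc.prems(1)]]) (use Suc.prems in auto)
    qed
  qed (simp add: D_compose[OF dif] D_basis_expansion[OF dif(2), symmetric])
  moreover have "(\<lambda>x. g (f x)) differentiable (at x)" if "x \<in> U" for x
    using differentiable_chain_at[OF dif[OF that]] by (simp add: o_def)
  ultimately show ?case by simp
qed

lemma smooth_on_cong:
  "\<lbrakk>smooth_on U f; open U; \<And>x. x \<in> U \<Longrightarrow> f x = g x\<rbrakk> \<Longrightarrow> smooth_on U g"
  unfolding smooth_on_def by (blast intro: Ck_on_cong)

lemma smooth_on_subset: "\<lbrakk>smooth_on U f; V \<subseteq> U\<rbrakk> \<Longrightarrow> smooth_on V f"
  unfolding smooth_on_def by (blast intro: Ck_on_subset)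

lemma smooth_on_local:
  assumes "\<And>x. x \<in> U \<Longrightarrow> \<exists>V. open V \<and> x \<in> V \<and> smooth_on V f"
  shows "smooth_on U f"
  unfolding smooth_on_def
proof (intro allI Ck_on_local)
  show "\<exists>V. open V \<and> x \<in> V \<and> Ck_on k V f" if "x \<in> U" for x k
    using assms[OF that] unfolding smooth_on_def by blast
qed

lemma smooth_on_differentiable: "\<lbrakk>smooth_on U f; x \<in> U\<rbrakk> \<Longrightarrow> f differentiable (at x)"
  unfolding smooth_on_def using Ck_on.simps(2) by blast

lemma smooth_on_continuous_on: "smooth_on U f \<Longrightarrow> continuous_on U f"
  unfolding smooth_on_def using Ck_on.simps(1) by blast

lemma smooth_on_D: "smooth_on U f \<Longrightarrow> smooth_on U (\<lambda>x. D f x v)"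
  unfolding smooth_on_def using Ck_on.simps(2) by blast

lemma smooth_onI:
  assumes "\<And>x. x \<in> U \<Longrightarrow> f differentiable (at x)" "\<And>v. smooth_on U (\<lambda>x. D f x v)"
  shows "smooth_on U f"
  unfolding smooth_on_def
proof
  fix k
  have "Ck_on (Suc k) U f"
    using assms unfolding smooth_on_def by auto
  then show "Ck_on k U f"
    by (rule Ck_on_SucD)
qed

lemma smooth_on_const: "smooth_on U (\<lambda>x. c)"
  by (simp add: smooth_on_def Ck_on_const)

lemma smooth_on_ident: "open U \<Longrightarrow> smooth_on U (\<lambda>x. x)"
  by (simp add: smooth_on_def Ck_on_ident)

lemma smooth_on_add:
  "\<lbrakk>open U; smooth_on U f; smooth_on U g\<rbrakk> \<Longrightarrow> smooth_on U (\<lambda>x. f x + g x)"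
  by (simp add: smooth_on_def Ck_on_add)

lemma smooth_on_bilinear:
  "\<lbrakk>bounded_bilinear h; open U; smooth_on U f; smooth_on U g\<rbrakk> \<Longrightarrow> smooth_on U (\<lambda>x. h (f x) (g x))"
  by (simp add: smooth_on_def Ck_on_bilinear)

lemmas smooth_on_inner = smooth_on_bilinear[OF bounded_bilinear_inner]
lemmas smooth_on_scaleR = smooth_on_bilinear[OF bounded_bilinear_scaleR]
lemmas smooth_on_mult = smooth_on_bilinear[OF bounded_bilinear_mult]

lemma smooth_on_bounded_linear:
  "\<lbrakk>bounded_linear h; open U; smooth_on U f\<rbrakk> \<Longrightarrow> smooth_on U (\<lambda>x. h (f x))"
  by (simp add: smooth_on_def Ck_on_bounded_linear)

lemmas smooth_on_fst = smooth_on_bounded_linear[OF bounded_linear_fst]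
lemmas smooth_on_snd = smooth_on_bounded_linear[OF bounded_linear_snd]

lemma smooth_on_diff:
  assumes "open U" "smooth_on U f" "smooth_on U g"
  shows "smooth_on U (\<lambda>x. f x - g x)"
  using smooth_on_add[OF assms(1,2) smooth_on_bounded_linear[OF bounded_linear_minus[OF bounded_linear_ident] assms(1,3)]]
  by simp

lemma smooth_on_sum:
  "\<lbrakk>open U; \<And>i. i \<in> I \<Longrightarrow> smooth_on U (f i)\<rbrakk> \<Longrightarrow> smooth_on U (\<lambda>x. \<Sum>i\<in>I. f i x)"
  by (simp add: smooth_on_def Ck_on_sum)

lemma smooth_on_Pair:
  assumes "open U" "smooth_on U f" "smooth_on U g"
  shows "smooth_on U (\<lambda>x. (f x, g x))"
proof -
  have "bounded_linear (\<lambda>a. (a, 0))" "bounded_linear (\<lambda>a. (0, a))"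
    by (intro bounded_linear_Pair bounded_linear_ident bounded_linear_zero)+
  from smooth_on_add[OF assms(1) smooth_on_bounded_linear[OF this(1) assms(1,2)]
      smooth_on_bounded_linear[OF this(2) assms(1,3)]]
  show ?thesis by simp
qed

lemma smooth_on_compose:
  fixes g :: "'b::euclidean_space \<Rightarrow> 'c::real_normed_vector"
  shows "\<lbrakk>open U; smooth_on U f; smooth_on V g; f ` U \<subseteq> V\<rbrakk> \<Longrightarrow> smooth_on U (\<lambda>x. g (f x))"
  by (simp add: smooth_on_def Ck_on_compose)

text \<open>The same basis expansion for an arbitrary moving direction; later the direction is a
  vector field or a value of the vertical endomorphism.\<close>

lemma smooth_on_D_apply:
  fixes f :: "'a::euclidean_space \<Rightarrow> 'b::real_normed_vector"
  assumes "open U" "smooth_on U f" "smooth_on U g"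
  shows "smooth_on U (\<lambda>x. D f x (g x))"
proof (rule smooth_on_cong[where f = "\<lambda>x. \<Sum>b\<in>Basis. (g x \<bullet> b) *\<^sub>R D f x b"])
  show "smooth_on U (\<lambda>x. \<Sum>b\<in>Basis. (g x \<bullet> b) *\<^sub>R D f x b)"
    using assms
    by (intro smooth_on_sum smooth_on_scaleR smooth_on_inner smooth_on_D smooth_on_const) auto
qed (use assms in \<open>auto intro!: D_basis_expansion[symmetric] dest: smooth_on_differentiable\<close>)

section \<open>Derivatives along lines and curves\<close>

lemma has_vector_derivative_line:
  assumes "f differentiable (at (x + s *\<^sub>R v))"
  shows "((\<lambda>s. f (x + s *\<^sub>R v)) has_vector_derivative D f (x + s *\<^sub>R v) v) (at s)"
proof -
  have "((\<lambda>s. x + s *\<^sub>R v) has_derivative (\<lambda>h. h *\<^sub>R v)) (at s)"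
    by (auto intro!: derivative_eq_intros)
  from diff_chain_at[OF this has_D[OF assms]]
  show ?thesis
    using linear_scale[OF linear_D[OF assms]]
    by (simp add: has_vector_derivative_def o_def)
qed

lemma has_vector_derivative_line_0:
  "f differentiable (at x) \<Longrightarrow> ((\<lambda>s. f (x + s *\<^sub>R v)) has_vector_derivative D f x v) (at 0)"
  using has_vector_derivative_line[of f x 0 v] by (simp only: scaleR_zero_left add_0_right)

lemma vector_derivative_compose:
  assumes "\<gamma> differentiable (at t)" "f differentiable (at (\<gamma> t))"
  shows "vector_derivative (\<lambda>s. f (\<gamma> s)) (at t) = D f (\<gamma> t) (vector_derivative \<gamma> (at t))"
proof -
  have "(\<gamma> has_vector_derivative vector_derivative \<gamma> (at t)) (at t)"
    using assms(1) by (simp add: vector_derivative_works)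
  then have "(\<gamma> has_derivative (\<lambda>h. h *\<^sub>R vector_derivative \<gamma> (at t))) (at t)"
    by (simp add: has_vector_derivative_def)
  from diff_chain_at[OF this has_D[OF assms(2)]] have "((\<lambda>s. f (\<gamma> s)) has_vector_derivative D f (\<gamma> t) (vector_derivative \<gamma> (at t))) (at t)"
    using linear_scale[OF linear_D[OF assms(2)]]
    by (simp add: has_vector_derivative_def o_def)
  then show ?thesis by (rule vector_derivative_at)
qed

section \<open>Symmetry of second derivatives\<close>

lemma DERIV_line:
  fixes f :: "'a::real_normed_vector \<Rightarrow> real"
  assumes "f differentiable (at (x + s *\<^sub>R v))"
  shows "DERIV (\<lambda>s. f (x + s *\<^sub>R v)) s :> D f (x + s *\<^sub>R v) v"
  using has_vector_derivative_line[OF assms]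
  by (simp add: has_real_derivative_iff_has_vector_derivative)

text \<open>The mean value theorem twice: first along v, for the increment of f across
  \<open>h *\<^sub>R w\<close>, then along w, for the directional derivative in direction v. The
  second difference is symmetric in v and w, while the right-hand side has a fixed order of
  differentiation.\<close>

lemma second_difference_mvt:
  fixes f :: "'a::real_normed_vector \<Rightarrow> real"
  assumes "smooth_on U f" "0 < h"
    and U: "\<And>s t. \<lbrakk>0 \<le> s; s \<le> h; 0 \<le> t; t \<le> h\<rbrakk> \<Longrightarrow> x + s *\<^sub>R v + t *\<^sub>R w \<in> U"
  shows "\<exists>s t. 0 < s \<and> s < h \<and> 0 < t \<and> t < h \<and>
    f (x + h *\<^sub>R v + h *\<^sub>R w) - f (x + h *\<^sub>R v) - f (x + h *\<^sub>R w) + f x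
      = h * h * D (\<lambda>z. D f z v) (x + s *\<^sub>R v + t *\<^sub>R w) w"
proof -
  have df: "f differentiable (at z)" "(\<lambda>z. D f z v) differentiable (at z)" if "z \<in> U" for z
    using that assms(1) smooth_on_D smooth_on_differentiable by blast+
  define g where "g s = f ((x + h *\<^sub>R w) + s *\<^sub>R v) - f (x + s *\<^sub>R v)" for s
  have "DERIV g s :> D f ((x + h *\<^sub>R w) + s *\<^sub>R v) v - D f (x + s *\<^sub>R v) v"
    if "0 \<le> s" "s \<le> h" for s
    unfolding g_def
    using U[of s 0] U[of s h] that assms(2)
    by (intro DERIV_diff DERIV_line df(1)) (auto simp: algebra_simps)
  from MVT2[OF assms(2) this] obtain s where s: "0 < s" "s < h"
    and gs: "g h - g 0 = h * (D f ((x + h *\<^sub>R w) + s *\<^sub>R v) v - D f (x + s *\<^sub>R v) v)"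
    by auto
  have "DERIV (\<lambda>t. D f ((x + s *\<^sub>R v) + t *\<^sub>R w) v) t :>
      D (\<lambda>z. D f z v) ((x + s *\<^sub>R v) + t *\<^sub>R w) w" if "0 \<le> t" "t \<le> h" for t
    using U[of s t] that s by (intro DERIV_line[of "\<lambda>z. D f z v"] df(2)) auto
  from MVT2[OF assms(2) this] obtain t where t: "0 < t" "t < h"
    and "D f ((x + s *\<^sub>R v) + h *\<^sub>R w) v - D f (x + s *\<^sub>R v) v
      = h * D (\<lambda>z. D f z v) ((x + s *\<^sub>R v) + t *\<^sub>R w) w"
    by auto
  moreover have "(x + h *\<^sub>R w) + s *\<^sub>R v = (x + s *\<^sub>R v) + h *\<^sub>R w"
    "(x + h *\<^sub>R w) + h *\<^sub>R v = (x + h *\<^sub>R v) + h *\<^sub>R w"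
    by (simp_all add: algebra_simps)
  ultimately have "g h - g 0 = h * (h * D (\<lambda>z. D f z v) ((x + s *\<^sub>R v) + t *\<^sub>R w) w)"
    using gs by metis
  moreover have "g h - g 0
      = f (x + h *\<^sub>R v + h *\<^sub>R w) - f (x + h *\<^sub>R v) - f (x + h *\<^sub>R w) + f x"
    unfolding g_def by (simp add: algebra_simps)
  ultimately show ?thesis
    using s t by (intro exI[of _ s] exI[of _ t]) (simp add: mult.assoc)
qed

text \<open>Both orders of differentiation represent the same second difference, each at some point
  of a small parallelogram at x. If they differed at x, continuity of the two mixed derivatives
  would be violated.\<close>

lemma second_derivative_symmetric_real:
  fixes f :: "'a::real_normed_vector \<Rightarrow> real"
  assumes "open U" "smooth_on U f" "x \<in> U"
  shows "D (\<lambda>z. D f z v) x w = D (\<lambda>z. D f z w) x v"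
proof (rule ccontr)
  define P where "P = (\<lambda>y. D (\<lambda>z. D f z v) y w)"
  define Q where "Q = (\<lambda>y. D (\<lambda>z. D f z w) y v)"
  assume "D (\<lambda>z. D f z v) x w \<noteq> D (\<lambda>z. D f z w) x v"
  then have PQ: "P x \<noteq> Q x" by (simp add: P_def Q_def)
  \<comment> \<open>Half of the gap: two numbers closer than e to P x and to Q x cannot be
    equal.\<close>
  define e where "e = dist (P x) (Q x) / 2"
  have "e > 0" using PQ by (simp add: e_def)
  have "continuous_on U P" "continuous_on U Q"
    unfolding P_def Q_def by (intro smooth_on_continuous_on smooth_on_D assms)+
  then have "isCont P x" "isCont Q x"
    using assms continuous_on_eq_continuous_at by blast+
  then have "\<forall>\<^sub>F y in nhds x. dist (P y) (P x) < e" "\<forall>\<^sub>F y in nhds x. dist (Q y) (Q x) < e"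
    using \<open>e > 0\<close> unfolding isCont_def tendsto_at_iff_tendsto_nhds by (blast dest: tendstoD)+
  moreover have "\<forall>\<^sub>F y in nhds x. y \<in> U"
    using assms by (simp add: eventually_nhds_in_open)
  ultimately have "\<forall>\<^sub>F y in nhds x. dist (P y) (P x) < e \<and> dist (Q y) (Q x) < e \<and> y \<in> U"
    by (simp add: eventually_conj)
  then obtain d where "d > 0"
    and d: "\<And>y. dist y x < d \<Longrightarrow> dist (P y) (P x) < e \<and> dist (Q y) (Q x) < e \<and> y \<in> U"
    unfolding eventually_nhds_metric by blast
  \<comment> \<open>The summand 1 keeps N positive when v = w = 0; with h = d / (2 N) the whole
    parallelogram lies within d / 2 of x.\<close>
  define N where "N = norm v + norm w + 1"
  define h where "h = d / (2 * N)"
  have pos: "N > 0"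
    by (simp add: N_def add_nonneg_pos)
  then have "h > 0" using \<open>d > 0\<close> by (simp add: h_def)
  have near: "dist (x + s *\<^sub>R v + t *\<^sub>R w) x < d" if "0 \<le> s" "s \<le> h" "0 \<le> t" "t \<le> h" for s t
  proof -
    have "dist (x + s *\<^sub>R v + t *\<^sub>R w) x = norm (s *\<^sub>R v + t *\<^sub>R w)"
      by (simp add: dist_norm algebra_simps)
    also have "\<dots> \<le> s * norm v + t * norm w"
      using norm_triangle_ineq[of "s *\<^sub>R v" "t *\<^sub>R w"] that by simp
    also have "\<dots> \<le> h * norm v + h * norm w"
      using that by (intro add_mono mult_right_mono) auto
    also have "\<dots> \<le> h * N"
      using \<open>h > 0\<close> by (simp add: N_def algebra_simps)
    also have "\<dots> = d / 2"
      using pos by (simp add: h_def)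
    also have "\<dots> < d" using \<open>d > 0\<close> by simp
    finally show ?thesis .
  qed
  obtain s t where st: "0 < s" "s < h" "0 < t" "t < h" and
    1: "f (x + h *\<^sub>R v + h *\<^sub>R w) - f (x + h *\<^sub>R v) - f (x + h *\<^sub>R w) + f x
      = h * h * P (x + s *\<^sub>R v + t *\<^sub>R w)"
    using second_difference_mvt[OF assms(2) \<open>h > 0\<close>, of x v w] near d unfolding P_def by blast
  have near': "dist (x + s *\<^sub>R w + t *\<^sub>R v) x < d" if "0 \<le> s" "s \<le> h" "0 \<le> t" "t \<le> h" for s t
    using near[of t s] that by (simp add: algebra_simps)
  obtain s' t' where st': "0 < s'" "s' < h" "0 < t'" "t' < h" and
    2: "f (x + h *\<^sub>R w + h *\<^sub>R v) - f (x + h *\<^sub>R w) - f (x + h *\<^sub>R v) + f x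
      = h * h * Q (x + s' *\<^sub>R w + t' *\<^sub>R v)"
    using second_difference_mvt[OF assms(2) \<open>h > 0\<close>, of x w v] near' d unfolding Q_def by blast
  have "x + h *\<^sub>R w + h *\<^sub>R v = x + h *\<^sub>R v + h *\<^sub>R w"
    by (simp add: algebra_simps)
  with 1 2 have "h * h * P (x + s *\<^sub>R v + t *\<^sub>R w) = h * h * Q (x + s' *\<^sub>R w + t' *\<^sub>R v)"
    by (simp only:)
  then have eq: "P (x + s *\<^sub>R v + t *\<^sub>R w) = Q (x + s' *\<^sub>R w + t' *\<^sub>R v)"
    using \<open>h > 0\<close> by simp
  have "dist (P (x + s *\<^sub>R v + t *\<^sub>R w)) (P x) < e" "dist (Q (x + s' *\<^sub>R w + t' *\<^sub>R v)) (Q x) < e"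
    using d near[of s t] near'[of s' t'] st st' by auto
  then have "dist (P x) (Q x) < e + e"
    using eq by (metis dist_triangle_less_add dist_commute)
  then show False by (simp add: e_def)
qed

text \<open>The mean value theorem is about real functions, so the vector case goes coordinatewise.
  It serves for transition maps, whose second derivatives have to cancel in
  \<open>ext_deriv\<close>.\<close>

lemma second_derivative_symmetric:
  fixes f :: "'a::real_normed_vector \<Rightarrow> 'b::euclidean_space"
  assumes "open U" "smooth_on U f" "x \<in> U"
  shows "D (\<lambda>z. D f z v) x w = D (\<lambda>z. D f z w) x v"
proof (rule euclidean_eqI)
  fix b :: 'b
  have *: "D (\<lambda>z. D f z v) x w \<bullet> b = D (\<lambda>z. D (\<lambda>y. f y \<bullet> b) z v) x w" for v w
  proof -
    have d: "(\<lambda>z. D f z v) differentiable (at x)"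
      using assms smooth_on_D smooth_on_differentiable by blast
    have "D (\<lambda>z. D f z v \<bullet> b) x = D (\<lambda>z. D (\<lambda>y. f y \<bullet> b) z v) x"
      by (rule D_cong[OF assms(1,3)])
        (auto intro!: D_compose_linear[OF bounded_linear_inner_left, symmetric]
           differentiable_bounded_linear[OF bounded_linear_inner_left] d
           smooth_on_differentiable[OF assms(2)])
    then show ?thesis
      using D_compose_linear[OF bounded_linear_inner_left d, of b w] by simp
  qed
  show "D (\<lambda>z. D f z v) x w \<bullet> b = D (\<lambda>z. D f z w) x v \<bullet> b"
    unfolding *
    by (rule second_derivative_symmetric_real[OF assms(1) _ assms(3)])
      (intro smooth_on_bounded_linear[OF bounded_linear_inner_left] assms)
qed

text \<open>The 1-form is the inner product with \<open>a\<close>, so closedness is the symmetry of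
  the derivative of \<open>a\<close>. The potential integrates the form along segments from a base
  point \<open>z0\<close>; convexity keeps them in V.\<close>

lemma poincare:
  fixes a :: "'a::euclidean_space \<Rightarrow> 'a"
  assumes "open V" "convex V" "smooth_on V a"
    and closed: "\<And>z u w. z \<in> V \<Longrightarrow> D a z u \<bullet> w = D a z w \<bullet> u"
  obtains f :: "'a \<Rightarrow> real" where "smooth_on V f" "\<And>z u. z \<in> V \<Longrightarrow> D f z u = a z \<bullet> u"
proof (cases "V = {}")
  case True
  then show ?thesis
    using that[of "\<lambda>_. 0"] smooth_on_const by auto
next
  case False
  then obtain z0 where z0: "z0 \<in> V" by blast
  define p where "p z s = z0 + s *\<^sub>R (z - z0)" for z :: 'a and s :: real
  have pV: "p z s \<in> V" if "z \<in> V" "s \<in> cbox 0 1" for z s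
  proof -
    have "p z s = (1 - s) *\<^sub>R z0 + s *\<^sub>R z"
      by (simp add: p_def algebra_simps)
    then show ?thesis
      using convexD[OF assms(2) z0 that(1), of "1 - s" s] that(2) by simp
  qed
  have da: "a differentiable (at z)" if "z \<in> V" for z
    using assms(3) smooth_on_differentiable that by blast
  define f where "f z = integral (cbox 0 1) (\<lambda>s. a (p z s) \<bullet> (z - z0))" for z
  \<comment> \<open>The derivative of the integrand with respect to the endpoint, written so that it
    can be recognised as an s-derivative. Its values are bounded linear functionals because
    \<open>leibniz_rule\<close> asks for them.\<close>
  define F where "F z s = blinfun_inner_right (a (p z s) + s *\<^sub>R D a (p z s) (z - z0))" for z s
  have ca: "continuous_on V a"
    by (rule smooth_on_continuous_on[OF assms(3)])
  have cp: "continuous_on (V \<times> cbox 0 1) (\<lambda>x. p (fst x) (snd x))"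
    unfolding p_def by (intro continuous_intros)
  have fder: "(f has_derivative (\<lambda>u. a z \<bullet> u)) (at z)" if z: "z \<in> V" for z
  proof -
    have "(f has_derivative integral (cbox 0 1) (F z)) (at z within V)"
      unfolding f_def
    proof (rule leibniz_rule[OF _ _ _ z assms(2)])
      fix y s assume y: "y \<in> V" and s: "s \<in> cbox (0::real) 1"
      have d: "a differentiable (at (p y s))"
        using da pV y s by blast
      have "((\<lambda>y. p y s) has_derivative (\<lambda>h. s *\<^sub>R h)) (at y)"
        unfolding p_def by (auto intro!: derivative_eq_intros)
      from has_derivative_compose[OF this has_D[OF d]]
      have ap: "((\<lambda>y. a (p y s)) has_derivative (\<lambda>h. D a (p y s) (s *\<^sub>R h))) (at y)" .
      have "((\<lambda>y. a (p y s) \<bullet> (y - z0)) has_derivative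
          (\<lambda>h. a (p y s) \<bullet> h + D a (p y s) (s *\<^sub>R h) \<bullet> (y - z0))) (at y)"
        using has_derivative_inner[OF ap has_derivative_diff[OF has_derivative_ident has_derivative_const]]
        by simp
      \<comment> \<open>Closedness swaps h and \<open>y - z0\<close>; the factor s comes from
        differentiating the point of the segment in its endpoint.\<close>
      moreover have "a (p y s) \<bullet> h + D a (p y s) (s *\<^sub>R h) \<bullet> (y - z0) = blinfun_apply (F y s) h" for h
        using closed[OF pV[OF y s], of h "y - z0"] linear_scale[OF linear_D[OF d]]
        by (simp add: F_def inner_add_left)
      ultimately show "((\<lambda>y. a (p y s) \<bullet> (y - z0)) has_derivative blinfun_apply (F y s)) (at y within V)"
        by (simp add: has_derivative_at_withinI)
    next
      fix y assume y: "y \<in> V"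
      have "continuous_on (cbox 0 1) (\<lambda>s. a (p y s))"
        using y pV by (intro continuous_on_compose2[OF ca]) (auto simp: p_def intro!: continuous_intros)
      then show "(\<lambda>s. a (p y s) \<bullet> (y - z0)) integrable_on cbox 0 1"
        by (intro integrable_continuous continuous_intros)
    next
      have 1: "continuous_on (V \<times> cbox 0 1) (\<lambda>x. a (p (fst x) (snd x)))"
        using pV by (intro continuous_on_compose2[OF ca cp]) auto
      \<comment> \<open>The direction \<open>fst x - z0\<close> varies too, so joint continuity is
        obtained from the fixed basis directions.\<close>
      have "continuous_on (V \<times> cbox 0 1) (\<lambda>x. D a (p (fst x) (snd x)) b)" for b
        by (rule continuous_on_compose2[OF smooth_on_continuous_on[OF smooth_on_D[OF assms(3)]] cp])
          (use pV in auto)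
      then have "continuous_on (V \<times> cbox 0 1)
          (\<lambda>x. \<Sum>b\<in>Basis. ((fst x - z0) \<bullet> b) *\<^sub>R D a (p (fst x) (snd x)) b)"
        by (intro continuous_intros)
      moreover have "(\<Sum>b\<in>Basis. ((fst x - z0) \<bullet> b) *\<^sub>R D a (p (fst x) (snd x)) b)
          = D a (p (fst x) (snd x)) (fst x - z0)" if "x \<in> V \<times> cbox 0 1" for x
        using pV that by (intro D_basis_expansion[symmetric] da) auto
      ultimately have 2: "continuous_on (V \<times> cbox 0 1) (\<lambda>x. D a (p (fst x) (snd x)) (fst x - z0))"
        by (metis (no_types, lifting) continuous_on_cong)
      have "continuous_on (V \<times> cbox 0 1) (\<lambda>x. F (fst x) (snd x))"
        unfolding F_def
        by (intro bounded_linear.continuous_on[OF bounded_linear_blinfun_inner_right] continuous_intros 1 2)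
      then show "continuous_on (V \<times> cbox 0 1) (\<lambda>(y, s). F y s)"
        by (simp add: case_prod_unfold)
    qed
    then have D1: "(f has_derivative integral (cbox 0 1) (F z)) (at z)"
      using at_within_open[OF z assms(1)] by simp
    \<comment> \<open>\<open>F z\<close> is an exact s-derivative, so its integral is a difference
      of boundary values: \<open>a z\<close> at s = 1, and 0 at s = 0 because of the factor
      s.\<close>
    have "((\<lambda>s. blinfun_inner_right (s *\<^sub>R a (p z s))) has_vector_derivative F z s) (at s)"
      if "s \<in> cbox 0 1" for s
    proof -
      have "a differentiable (at (z0 + s *\<^sub>R (z - z0)))"
        using da pV[OF z that] by (simp add: p_def)
      from has_vector_derivative_line[OF this]
      have "((\<lambda>s. a (p z s)) has_vector_derivative D a (p z s) (z - z0)) (at s)"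
        by (simp add: p_def)
      from has_vector_derivative_scaleR[OF DERIV_ident this]
      have "((\<lambda>s. s *\<^sub>R a (p z s)) has_vector_derivative
          s *\<^sub>R D a (p z s) (z - z0) + a (p z s)) (at s)"
        by simp
      from bounded_linear.has_vector_derivative[OF bounded_linear_blinfun_inner_right this]
      show ?thesis by (simp add: F_def add.commute)
    qed
    then have "(F z has_integral
        (blinfun_inner_right (1 *\<^sub>R a (p z 1)) - blinfun_inner_right (0 *\<^sub>R a (p z 0)))) {0..1}"
      by (intro fundamental_theorem_of_calculus) (auto intro: has_vector_derivative_at_within)
    then have "integral (cbox 0 1) (F z) = blinfun_inner_right (a z)"
      by (simp add: p_def integral_unique linear_0[OF bounded_linear.linear[OF bounded_linear_blinfun_inner_right]])
    with D1 show ?thesis by simp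
  qed
  show ?thesis
  proof (rule that[of f])
    show Df: "D f z u = a z \<bullet> u" if "z \<in> V" for z u
      using D_eqI[OF fder[OF that]] by simp
    show "smooth_on V f"
    proof (rule smooth_onI)
      show "f differentiable (at z)" if "z \<in> V" for z
        using fder[OF that] by (rule differentiableI)
      show "smooth_on V (\<lambda>z. D f z u)" for u
        by (rule smooth_on_cong[OF smooth_on_bounded_linear[OF bounded_linear_inner_left assms(1,3)] assms(1)])
          (simp add: Df)
    qed
  qed
qed

section \<open>Forms and vector fields in charts\<close>

lemma chart_inv_in: "z \<in> snd c ` X \<Longrightarrow> X \<subseteq> fst c \<Longrightarrow> chart_inv c z \<in> fst c"
  unfolding chart_inv_def by (rule inv_into_into) blast

lemma chart_of_inv: "z \<in> snd c ` X \<Longrightarrow> X \<subseteq> fst c \<Longrightarrow> snd c (chart_inv c z) = z"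
  unfolding chart_inv_def by (rule f_inv_into_f) blast

lemma chart_eqD: "\<lbrakk>snd c p = snd c q; is_chart c; p \<in> fst c; q \<in> fst c\<rbrakk> \<Longrightarrow> p = q"
  by (auto simp: is_chart_def inj_on_def)

lemma chart_inv_chart: "\<lbrakk>is_chart c; p \<in> fst c\<rbrakk> \<Longrightarrow> chart_inv c (snd c p) = p"
  unfolding chart_inv_def is_chart_def by (simp add: inv_into_f_f)

lemma chart_inv_in_subset:
  "\<lbrakk>is_chart c; z \<in> snd c ` X; X \<subseteq> fst c\<rbrakk> \<Longrightarrow> chart_inv c z \<in> X"
  by (auto simp: chart_inv_chart subset_iff)

text \<open>The covector at z is stored as the vector that represents it by the inner product. A
  1-form in a chart is then a single vector function, and its derivative carries all partial
  derivatives of the coefficients.\<close>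

definition form_coeffs ::
    "('p, 'e::euclidean_space) atlas \<Rightarrow> ('p, 'e) chart \<Rightarrow> 'p form1 \<Rightarrow> 'e \<Rightarrow> 'e" where
  "form_coeffs A c \<theta> z = (\<Sum>b\<in>Basis. in_chart A c \<theta> z b *\<^sub>R b)"

definition field_coeffs :: "('p, 'e::euclidean_space) chart \<Rightarrow> ('p \<Rightarrow> 'p tvec) \<Rightarrow> 'e \<Rightarrow> 'e" where
  "field_coeffs c X z = components c (X (chart_inv c z))"

text \<open>The structure that chart computations rest on, isolated so that the results apply alike
  to the given atlas, to its maximal atlas and to the jet atlas.\<close>

locale compatible_atlas =
  fixes B :: "('p, 'e::euclidean_space) atlas"
  assumes charts: "c \<in> B \<Longrightarrow> is_chart c"
    and compat: "\<lbrakk>c \<in> B; d \<in> B\<rbrakk> \<Longrightarrow> compatible c d"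
begin

abbreviation opn :: "'p set \<Rightarrow> bool" where
  "opn W \<equiv> openin (manifold_topology B) W"

lemmas inv_chart = chart_inv_chart[OF charts]

lemma opn_chart_preimage: "\<lbrakk>c \<in> B; open V\<rbrakk> \<Longrightarrow> opn (fst c \<inter> snd c -` V)"
  unfolding manifold_topology_def by (rule topology_generated_by_Basis) blast

lemma opn_domain: "c \<in> B \<Longrightarrow> opn (fst c)"
  using opn_chart_preimage[of c UNIV] by simp

lemma opn_points: "opn (points B)"
  unfolding points_def by (rule openin_Union) (auto dest: opn_domain)

lemma transition_smooth:
  assumes "c \<in> B" "d \<in> B"
  shows "open (snd c ` (fst c \<inter> fst d))"
    and "smooth_on (snd c ` (fst c \<inter> fst d)) (\<lambda>z. snd d (chart_inv c z))"
  using compat[OF assms] unfolding compatible_def by (simp_all add: o_def)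

text \<open>Induction over the generation of the topology. Injectivity of the chart makes images
  commute with intersections, and a generator from another chart is handled by continuity of the
  transition map.\<close>

lemma open_chart_image:
  assumes "opn W" "c \<in> B"
  shows "open (snd c ` (W \<inter> fst c))"
proof -
  have "generate_topology_on {fst c \<inter> snd c -` V | c V. c \<in> B \<and> open V} W"
    using assms(1) unfolding manifold_topology_def by (simp add: openin_topology_generated_by_iff)
  then show ?thesis
  proof induction
    case Empty
    then show ?case by simp
  next
    case (Int a b)
    have "snd c ` (a \<inter> b \<inter> fst c) = snd c ` (a \<inter> fst c) \<inter> snd c ` (b \<inter> fst c)"
      using inj_on_image_Int[of "snd c" "fst c" "a \<inter> fst c" "b \<inter> fst c"] charts[OF assms(2)]
      unfolding is_chart_def by (auto simp: Int_ac)
    with Int show ?case by (simp add: open_Int)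
  next
    case (UN K)
    have "snd c ` (\<Union> K \<inter> fst c) = (\<Union>k\<in>K. snd c ` (k \<inter> fst c))" by blast
    with UN show ?case by auto
  next
    case (Basis s)
    then obtain d V where d: "d \<in> B" "open V" "s = fst d \<inter> snd d -` V" by blast
    let ?U = "snd c ` (fst c \<inter> fst d)"
    have "snd c ` (s \<inter> fst c) = ?U \<inter> (\<lambda>z. snd d (chart_inv c z)) -` V"
      using d by (auto simp: inv_chart[OF assms(2)])
    moreover have "open (?U \<inter> (\<lambda>z. snd d (chart_inv c z)) -` V)"
      using transition_smooth[OF assms(2) d(1)] d(2)
      by (metis Int_commute continuous_on_open_vimage smooth_on_continuous_on)
    ultimately show ?case by simp
  qed
qed

lemma smooth_funD:
  "\<lbrakk>smooth_fun B W f; c \<in> B\<rbrakk> \<Longrightarrow> smooth_on (snd c ` (W \<inter> fst c)) (\<lambda>z. f (chart_inv c z))"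
  unfolding smooth_fun_def by (auto simp: o_def)

text \<open>Composition with transition maps carries smoothness from one chart to all others. This
  is how a potential found in coordinates becomes a function on the manifold.\<close>

lemma smooth_funI_chart:
  assumes c: "c \<in> B" and V: "open V" "V \<subseteq> snd c ` fst c"
    and f: "smooth_on V (\<lambda>z. f (chart_inv c z))"
  shows "smooth_fun B (fst c \<inter> snd c -` V) f"
  unfolding smooth_fun_def
proof
  fix d assume d: "d \<in> B"
  let ?W = "fst c \<inter> snd c -` V"
  have op: "open (snd d ` (?W \<inter> fst d))"
    by (rule open_chart_image[OF opn_chart_preimage[OF c V(1)] d])
  show "smooth_on (snd d ` (?W \<inter> fst d)) (f \<circ> chart_inv d)"
  proof (rule smooth_on_cong[OF smooth_on_compose[OF op _ f, of "\<lambda>z. snd c (chart_inv d z)"] op])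
    show "smooth_on (snd d ` (?W \<inter> fst d)) (\<lambda>z. snd c (chart_inv d z))"
      by (rule smooth_on_subset[OF transition_smooth(2)[OF d c]]) blast
  qed (auto simp: inv_chart[OF d] inv_chart[OF c])
qed

lemma smooth_nearI: "\<lbrakk>opn W; p \<in> W; smooth_fun B W f\<rbrakk> \<Longrightarrow> smooth_near B p f"
  unfolding smooth_near_def by blast

lemma smooth_near_chart:
  assumes "smooth_near B p f" "c \<in> B" "p \<in> fst c"
  obtains V where "open V" "snd c p \<in> V" "V \<subseteq> snd c ` fst c" "smooth_on V (\<lambda>z. f (chart_inv c z))"
proof -
  obtain W where W: "opn W" "p \<in> W" "smooth_fun B W f"
    using assms(1) unfolding smooth_near_def by blast
  show ?thesis
    by (rule that[of "snd c ` (W \<inter> fst c)"])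
      (use W assms open_chart_image smooth_funD in auto)
qed

text \<open>\<open>components\<close> applies a tangent vector to coordinate functions, and a
  tangent vector has the default value 0 on functions not smooth near its base point. So the
  components are right only because coordinates are smooth on the chart domain.\<close>

lemma smooth_fun_coordinate:
  assumes "c \<in> B"
  shows "smooth_fun B (fst c) (\<lambda>q. snd c q \<bullet> b)"
proof -
  have op: "open (snd c ` fst c)"
    using charts[OF assms(1)] by (simp add: is_chart_def)
  have "smooth_on (snd c ` fst c) (\<lambda>z. snd c (chart_inv c z) \<bullet> b)"
    by (rule smooth_on_cong[OF smooth_on_bounded_linear[OF bounded_linear_inner_left op smooth_on_ident[OF op]] op])
      (simp add: chart_of_inv)
  from smooth_funI_chart[OF assms(1) op _ this] show ?thesis
    by (simp add: Int_absorb2 image_subset_iff_subset_vimage[symmetric])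
qed

lemma smooth_near_coordinate:
  "\<lbrakk>c \<in> B; p \<in> fst c\<rbrakk> \<Longrightarrow> smooth_near B p (\<lambda>q. snd c q \<bullet> b)"
  by (rule smooth_nearI[OF opn_domain _ smooth_fun_coordinate])

section \<open>Tangent vectors and change of chart\<close>

lemma tangent_smooth:
  "smooth_near B p f \<Longrightarrow> tangent B c p u f = D (\<lambda>z. f (chart_inv c z)) (snd c p) u"
  by (simp add: tangent_def o_def)

lemma smooth_fun_cong:
  assumes "smooth_fun B W f" "opn W" "\<And>q. q \<in> W \<Longrightarrow> f q = g q"
  shows "smooth_fun B W g"
  unfolding smooth_fun_def o_def
proof
  fix c assume c: "c \<in> B"
  show "smooth_on (snd c ` (W \<inter> fst c)) (\<lambda>z. g (chart_inv c z))"
    by (rule smooth_on_cong[OF smooth_funD[OF assms(1) c] open_chart_image[OF assms(2) c]])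
      (use inv_chart[OF c] assms(3) in auto)
qed

lemma tangent_smooth_fun:
  assumes "smooth_fun B W f" "opn W" "p \<in> W"
  shows "tangent B c p u f = D (\<lambda>z. f (chart_inv c z)) (snd c p) u"
  by (rule tangent_smooth[OF smooth_nearI[OF assms(2,3,1)]])

text \<open>Tangent vectors are local, but they are functionals with a default value, so smoothness
  near p has to be transferred to g together with the derivative.\<close>

lemma tangent_cong:
  assumes f: "smooth_fun B W f" and W: "opn W" "p \<in> W" and eq: "\<And>q. q \<in> W \<Longrightarrow> f q = g q"
    and c: "c \<in> B" "p \<in> fst c"
  shows "tangent B c p u f = tangent B c p u g"
proof -
  have p: "snd c p \<in> snd c ` (W \<inter> fst c)" using W(2) c(2) by blast
  have "D (\<lambda>z. f (chart_inv c z)) (snd c p) = D (\<lambda>z. g (chart_inv c z)) (snd c p)"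
    by (rule D_cong[OF open_chart_image[OF W(1) c(1)] p])
      (use smooth_on_differentiable[OF smooth_funD[OF f c(1)] p] inv_chart[OF c(1)] eq in auto)
  then show ?thesis
    by (simp add: tangent_smooth_fun[OF f W] tangent_smooth_fun[OF smooth_fun_cong[OF f W(1) eq] W])
qed

text \<open>An equality of functionals: on functions smooth near p it is the chain rule for the
  transition map, on all others both sides have the default value 0.\<close>

lemma tangent_change:
  assumes c: "c \<in> B" and d: "d \<in> B" and p: "p \<in> fst c" "p \<in> fst d"
  shows "tangent B d p u = tangent B c p (D (\<lambda>z. snd c (chart_inv d z)) (snd d p) u)"
proof
  fix f
  show "tangent B d p u f = tangent B c p (D (\<lambda>z. snd c (chart_inv d z)) (snd d p) u) f"
  proof (cases "smooth_near B p f")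
    case True
    obtain V where V: "open V" "snd c p \<in> V" "smooth_on V (\<lambda>z. f (chart_inv c z))"
      by (rule smooth_near_chart[OF True c p(1)])
    let ?U = "snd d ` (fst d \<inter> fst c)" and ?\<psi> = "\<lambda>z. snd c (chart_inv d z)"
    have U: "open ?U" "snd d p \<in> ?U"
      using transition_smooth(1)[OF d c] p by auto
    have \<psi>: "?\<psi> differentiable (at (snd d p))" "?\<psi> (snd d p) = snd c p"
      using smooth_on_differentiable[OF transition_smooth(2)[OF d c] U(2)] inv_chart[OF d p(2)] by simp_all
    have f: "(\<lambda>z. f (chart_inv c z)) differentiable (at (?\<psi> (snd d p)))"
      using smooth_on_differentiable[OF V(3,2)] \<psi>(2) by simp
    have "D (\<lambda>z. f (chart_inv c (?\<psi> z))) (snd d p) = D (\<lambda>z. f (chart_inv d z)) (snd d p)"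
    proof (rule D_cong[OF U])
      show "(\<lambda>z. f (chart_inv c (?\<psi> z))) differentiable (at (snd d p))"
        using differentiable_chain_at[OF \<psi>(1) f] by (simp add: o_def)
    qed (auto simp: inv_chart[OF d] inv_chart[OF c])
    then have "D (\<lambda>z. f (chart_inv d z)) (snd d p) u = D (\<lambda>z. f (chart_inv c z)) (snd c p) (D ?\<psi> (snd d p) u)"
      using D_compose[OF \<psi>(1) f, of u] unfolding \<psi>(2) by (rule trans[OF fun_cong[OF sym]])
    then show ?thesis
      unfolding tangent_smooth[OF True] .
  qed (simp add: tangent_def)
qed

lemma tangent_coordinate:
  assumes "c \<in> B" "p \<in> fst c"
  shows "tangent B c p u (\<lambda>q. snd c q \<bullet> b) = u \<bullet> b"
proof -
  have op: "open (snd c ` fst c)" and p: "snd c p \<in> snd c ` fst c"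
    using charts[OF assms(1)] assms(2) by (simp_all add: is_chart_def)
  have "D (\<lambda>z. z \<bullet> b) (snd c p) = (\<lambda>z. z \<bullet> b)"
    by (rule D_eqI[OF bounded_linear_imp_has_derivative[OF bounded_linear_inner_left]])
  moreover have "D (\<lambda>z. z \<bullet> b) (snd c p) = D (\<lambda>z. snd c (chart_inv c z) \<bullet> b) (snd c p)"
    by (rule D_cong[OF op p])
      (auto simp: chart_of_inv intro: bounded_linear_imp_differentiable[OF bounded_linear_inner_left])
  ultimately show ?thesis
    unfolding tangent_smooth[OF smooth_near_coordinate[OF assms]] by metis
qed

lemma components_tangent:
  "\<lbrakk>c \<in> B; p \<in> fst c\<rbrakk> \<Longrightarrow> components c (tangent B c p u) = u"
  unfolding components_def by (simp add: tangent_coordinate euclidean_representation)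

lemma components_tangent_change:
  assumes "c \<in> B" "d \<in> B" "p \<in> fst c" "p \<in> fst d"
  shows "components c (tangent B d p u) = D (\<lambda>z. snd c (chart_inv d z)) (snd d p) u"
  using assms by (simp add: tangent_change[OF assms] components_tangent)

lemma chart_at_props:
  assumes "p \<in> points B"
  shows "chart_at B p \<in> B" "p \<in> fst (chart_at B p)"
proof -
  have "\<exists>c. c \<in> B \<and> p \<in> fst c" using assms by (auto simp: points_def)
  from someI_ex[OF this] show "chart_at B p \<in> B" "p \<in> fst (chart_at B p)"
    unfolding chart_at_def by auto
qed

lemma chart_pointsI: "c \<in> B \<Longrightarrow> p \<in> fst c \<Longrightarrow> p \<in> points B"
  by (auto simp: points_def)

lemma opn_subset_points: "opn W \<Longrightarrow> W \<subseteq> points B"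
proof -
  assume "opn W"
  then have "generate_topology_on {fst c \<inter> snd c -` V | c V. c \<in> B \<and> open V} W"
    unfolding manifold_topology_def by (simp add: openin_topology_generated_by_iff)
  then show ?thesis
    by induction (auto simp: points_def)
qed

lemma tangent_in_space: "\<lbrakk>c \<in> B; p \<in> fst c\<rbrakk> \<Longrightarrow> tangent B c p u \<in> tangent_space B p"
  unfolding tangent_space_def by blast

text \<open>\<open>tangent_space\<close> collects vectors written in arbitrary charts. By
  \<open>tangent_change\<close> each of them can be written in c, so a claim about all tangent
  vectors reduces to one chart.\<close>

lemma tangent_space_eq:
  assumes "c \<in> B" "p \<in> fst c" "v \<in> tangent_space B p"
  shows "v = tangent B c p (components c v)"
proof -
  obtain d u where d: "d \<in> B" "p \<in> fst d" "v = tangent B d p u"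
    using assms(3) unfolding tangent_space_def by blast
  then show ?thesis
    using tangent_change[OF assms(1) d(1) assms(2) d(2), of u]
    by (simp add: components_tangent[OF assms(1,2)])
qed

section \<open>One-forms and the exterior derivative in a chart\<close>

lemma form_at_tangent:
  assumes "c \<in> B" "p \<in> fst c"
  shows "\<theta> p (tangent B c p u) = in_chart B c \<theta> (snd c p) u"
  by (simp add: in_chart_def inv_chart[OF assms])

lemma form_coeffs_inner:
  assumes "one_form B W \<theta>" "c \<in> B" "z \<in> snd c ` (W \<inter> fst c)"
  shows "in_chart B c \<theta> z u = form_coeffs B c \<theta> z \<bullet> u"
proof -
  have "linear (in_chart B c \<theta> z)"
    using assms unfolding one_form_def by blast
  from linear_basis_expansion[OF this, of u] show ?thesis
    by (simp add: form_coeffs_def inner_sum_left inner_commute[of u] mult.commute)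
qed

lemma form_coeffs_smooth:
  assumes "one_form B W \<theta>" "c \<in> B" "opn W"
  shows "smooth_on (snd c ` (W \<inter> fst c)) (form_coeffs B c \<theta>)"
proof -
  have "\<And>u. smooth_on (snd c ` (W \<inter> fst c)) (\<lambda>z. in_chart B c \<theta> z u)"
    using assms(1,2) unfolding one_form_def by blast
  then show ?thesis
    unfolding form_coeffs_def
    by (intro smooth_on_sum smooth_on_scaleR smooth_on_const open_chart_image[OF assms(3,2)])
qed

lemma form_coeffs_unique:
  assumes "\<And>u. in_chart B c \<theta> z u = a \<bullet> u"
  shows "form_coeffs B c \<theta> z = a"
  unfolding form_coeffs_def assms by (simp add: euclidean_representation)

lemma form_coeffs_D:
  assumes "one_form B W \<theta>" "c \<in> B" "opn W" "z \<in> snd c ` (W \<inter> fst c)"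
  shows "D (\<lambda>z. in_chart B c \<theta> z w) z u = D (form_coeffs B c \<theta>) z u \<bullet> w"
proof -
  have d: "form_coeffs B c \<theta> differentiable (at z)"
    by (rule smooth_on_differentiable[OF form_coeffs_smooth[OF assms(1-3)] assms(4)])
  have "D (\<lambda>z. form_coeffs B c \<theta> z \<bullet> w) z = D (\<lambda>z. in_chart B c \<theta> z w) z"
    by (rule D_cong[OF open_chart_image[OF assms(3,2)] assms(4)])
      (auto simp: form_coeffs_inner[OF assms(1,2)]
         intro!: differentiable_bounded_linear[OF bounded_linear_inner_left] d)
  then show ?thesis
    using D_compose_linear[OF bounded_linear_inner_left d, of w u] by simp
qed

text \<open>The second derivatives of the transition map cancel in the antisymmetrization.\<close>
lemma ext_deriv_chart:
  assumes \<theta>: "one_form B W \<theta>" and W: "opn W" and c: "c \<in> B" and p: "p \<in> W" "p \<in> fst c"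
  shows "ext_deriv B \<theta> p (tangent B c p u) (tangent B c p w) =
    D (form_coeffs B c \<theta>) (snd c p) u \<bullet> w - D (form_coeffs B c \<theta>) (snd c p) w \<bullet> u"
proof -
  \<comment> \<open>The chart in which \<open>ext_deriv\<close> is evaluated at p, while c is
    arbitrary.\<close>
  define d where "d = chart_at B p"
  have d: "d \<in> B" "p \<in> fst d"
    unfolding d_def using chart_at_props chart_pointsI[OF c p(2)] by auto
  define \<psi> where "\<psi> = (\<lambda>z. snd d (chart_inv c z))"
  define z where "z = snd c p"
  define a where "a = form_coeffs B c \<theta>"
  define a' where "a' = form_coeffs B d \<theta>"
  define U where "U = snd c ` ((W \<inter> fst d) \<inter> fst c)"
  have U: "open U" "z \<in> U"
    unfolding U_def z_def
    using open_chart_image[OF openin_Int[OF W opn_domain[OF d(1)]] c] d p by auto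
  have \<psi>s: "smooth_on U \<psi>"
    unfolding U_def \<psi>_def by (rule smooth_on_subset[OF transition_smooth(2)[OF c d(1)]]) blast
  have \<psi>z: "\<psi> z = snd d p" unfolding \<psi>_def z_def using inv_chart[OF c p(2)] by simp
  have as: "smooth_on (snd c ` (W \<inter> fst c)) a" "smooth_on (snd d ` (W \<inter> fst d)) a'"
    unfolding a_def a'_def using form_coeffs_smooth[OF \<theta> _ W] c d by auto
  have \<psi>d: "\<psi> differentiable (at z)" and \<psi>dd: "\<And>w. (\<lambda>y. D \<psi> y w) differentiable (at z)"
    using smooth_on_differentiable[OF \<psi>s U(2)] smooth_on_differentiable[OF smooth_on_D[OF \<psi>s] U(2)] by auto
  have ad: "a differentiable (at z)" "a' differentiable (at (\<psi> z))"
    using smooth_on_differentiable[OF as(1), of z] smooth_on_differentiable[OF as(2), of "\<psi> z"] p d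
    unfolding \<psi>z by (auto simp: z_def)
  have \<psi>'d: "(\<lambda>y. a' (\<psi> y)) differentiable (at z)"
    using differentiable_chain_at[OF \<psi>d ad(2)] by (simp add: o_def)
  \<comment> \<open>The transformation law of covectors: \<open>a\<close> is the pullback of
    \<open>a'\<close> along \<open>\<psi>\<close>. It holds on an open set around z, so it can be
    differentiated.\<close>
  have pull: "a y \<bullet> w = a' (\<psi> y) \<bullet> D \<psi> y w" if y: "y \<in> U" for y w
  proof -
    obtain q where q: "q \<in> W" "q \<in> fst d" "q \<in> fst c" "y = snd c q"
      using y unfolding U_def by blast
    have "a y \<bullet> w = \<theta> q (tangent B c q w)"
      using form_coeffs_inner[OF \<theta> c, of y w] q form_at_tangent[OF c q(3), of \<theta> w] by (auto simp: a_def)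
    also have "tangent B c q w = tangent B d q (D \<psi> y w)"
      using tangent_change[OF d(1) c q(2,3), of w] q by (simp add: \<psi>_def)
    also have "\<theta> q \<dots> = a' (snd d q) \<bullet> D \<psi> y w"
      using form_coeffs_inner[OF \<theta> d(1), of "snd d q" "D \<psi> y w"] q form_at_tangent[OF d(1) q(2), of \<theta>]
      by (auto simp: a'_def)
    also have "snd d q = \<psi> y"
      using q inv_chart[OF c q(3)] by (simp add: \<psi>_def)
    finally show ?thesis .
  qed
  have Da: "D a z u \<bullet> w = a' (\<psi> z) \<bullet> D (\<lambda>y. D \<psi> y w) z u + D a' (\<psi> z) (D \<psi> z u) \<bullet> D \<psi> z w" for u w
  proof -
    have "D a z u \<bullet> w = D (\<lambda>y. a y \<bullet> w) z u"
      by (simp add: D_compose_linear[OF bounded_linear_inner_left ad(1)])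
    also have "D (\<lambda>y. a y \<bullet> w) z = D (\<lambda>y. a' (\<psi> y) \<bullet> D \<psi> y w) z"
      by (rule D_cong[OF U pull]) (auto intro: differentiable_bounded_linear[OF bounded_linear_inner_left] ad(1))
    also have "\<dots> u = a' (\<psi> z) \<bullet> D (\<lambda>y. D \<psi> y w) z u + D (\<lambda>y. a' (\<psi> y)) z u \<bullet> D \<psi> z w"
      by (rule D_inner[OF \<psi>'d \<psi>dd])
    finally show ?thesis
      by (simp add: D_compose[OF \<psi>d ad(2)])
  qed
  have comp: "components d (tangent B c p u) = D \<psi> z u" for u
    using components_tangent_change[OF d(1) c d(2) p(2)] by (simp add: \<psi>_def z_def)
  have "ext_deriv B \<theta> p (tangent B c p u) (tangent B c p w) =
      D (\<lambda>y. in_chart B d \<theta> y (D \<psi> z w)) (\<psi> z) (D \<psi> z u) -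
      D (\<lambda>y. in_chart B d \<theta> y (D \<psi> z u)) (\<psi> z) (D \<psi> z w)"
    unfolding ext_deriv_def d_def[symmetric] Let_def comp \<psi>z[symmetric] ..
  also have "\<dots> = D a' (\<psi> z) (D \<psi> z u) \<bullet> D \<psi> z w - D a' (\<psi> z) (D \<psi> z w) \<bullet> D \<psi> z u"
    unfolding a'_def using p d \<psi>z by (simp add: form_coeffs_D[OF \<theta> d(1) W])
  also have "\<dots> = D a z u \<bullet> w - D a z w \<bullet> u"
    unfolding Da using second_derivative_symmetric[OF U(1) \<psi>s U(2), of u w] by simp
  finally show ?thesis
    by (simp add: a_def z_def)
qed

lemma closed_form_chart:
  assumes "one_form B W \<theta>" "opn W" "c \<in> B" "closed_form B W \<theta>" "z \<in> snd c ` (W \<inter> fst c)"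
  shows "D (form_coeffs B c \<theta>) z u \<bullet> w = D (form_coeffs B c \<theta>) z w \<bullet> u"
proof -
  obtain p where p: "p \<in> W" "p \<in> fst c" "z = snd c p" using assms(5) by blast
  then have "ext_deriv B \<theta> p (tangent B c p u) (tangent B c p w) = 0"
    using assms(4) tangent_in_space[OF assms(3) p(2)] unfolding closed_form_def by blast
  then show ?thesis
    using ext_deriv_chart[OF assms(1,2,3) p(1,2)] p(3) by simp
qed

text \<open>In the chart, closedness is the symmetry of the derivative of the coefficient vector,
  and a ball inside the open chart image supplies the convexity that \<open>poincare\<close>
  needs.\<close>

lemma local_potential:
  assumes \<alpha>: "one_form B W \<alpha>" and W: "opn W" and cl: "closed_form B W \<alpha>"
    and c: "c \<in> B" and p: "p \<in> W" "p \<in> fst c"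
  obtains V and f :: "'e \<Rightarrow> real" where "open V" "snd c p \<in> V" "V \<subseteq> snd c ` (W \<inter> fst c)" "smooth_on V f"
    "\<forall>z\<in>V. \<forall>u. D f z u = form_coeffs B c \<alpha> z \<bullet> u"
proof -
  have "snd c p \<in> snd c ` (W \<inter> fst c)"
    using p by blast
  then obtain e where e: "e > 0" "ball (snd c p) e \<subseteq> snd c ` (W \<inter> fst c)"
    by (rule openE[OF open_chart_image[OF W c]])
  have "smooth_on (ball (snd c p) e) (form_coeffs B c \<alpha>)"
    by (rule smooth_on_subset[OF form_coeffs_smooth[OF \<alpha> c W] e(2)])
  moreover have "D (form_coeffs B c \<alpha>) z u \<bullet> w = D (form_coeffs B c \<alpha>) z w \<bullet> u"
    if "z \<in> ball (snd c p) e" for z u w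
    by (rule closed_form_chart[OF \<alpha> W c cl]) (use that e(2) in blast)
  ultimately show ?thesis
  proof (rule poincare[OF open_ball convex_ball])
    fix f :: "'e \<Rightarrow> real"
    assume "smooth_on (ball (snd c p) e) f"
      "\<And>z u. z \<in> ball (snd c p) e \<Longrightarrow> D f z u = form_coeffs B c \<alpha> z \<bullet> u"
    then show thesis
      by (intro that[of "ball (snd c p) e" f]) (use e in auto)
  qed
qed

section \<open>Vector fields and the Lie derivative in a chart\<close>

lemma vector_field_subset:
  assumes "vector_field B W X" "W' \<subseteq> W"
  shows "vector_field B W' X"
proof -
  have "snd c ` (W' \<inter> fst c) \<subseteq> snd c ` (W \<inter> fst c)" for c :: "('p, 'e) chart"
    using assms(2) by blast
  then show ?thesis
    using assms unfolding vector_field_def by (meson smooth_on_subset subsetD)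
qed

lemma field_coeffs_smooth:
  "\<lbrakk>vector_field B W X; c \<in> B\<rbrakk> \<Longrightarrow> smooth_on (snd c ` (W \<inter> fst c)) (field_coeffs c X)"
  unfolding vector_field_def field_coeffs_def by blast

lemma field_coeffs_tangent:
  assumes "vector_field B W X" "c \<in> B" "p \<in> W" "p \<in> fst c"
  shows "X p = tangent B c p (field_coeffs c X (snd c p))"
  unfolding field_coeffs_def inv_chart[OF assms(2,4)]
  by (rule tangent_space_eq[OF assms(2,4)]) (use assms in \<open>auto simp: vector_field_def\<close>)

lemma interior1_chart:
  assumes "one_form B W \<theta>" "vector_field B W X" "c \<in> B" "z \<in> snd c ` (W \<inter> fst c)"
  shows "interior1 X \<theta> (chart_inv c z) = form_coeffs B c \<theta> z \<bullet> field_coeffs c X z"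
proof -
  obtain p where p: "p \<in> W" "p \<in> fst c" "z = snd c p" using assms(4) by blast
  show ?thesis
    using field_coeffs_tangent[OF assms(2,3) p(1,2)] form_at_tangent[OF assms(3) p(2)]
      form_coeffs_inner[OF assms(1,3,4)] p inv_chart[OF assms(3) p(2)]
    by (simp add: interior1_def)
qed

lemma smooth_interior1:
  assumes "one_form B W \<theta>" "vector_field B W X" "opn W"
  shows "smooth_fun B W (interior1 X \<theta>)"
  unfolding smooth_fun_def o_def
proof
  fix c assume c: "c \<in> B"
  note op = open_chart_image[OF assms(3) c]
  show "smooth_on (snd c ` (W \<inter> fst c)) (\<lambda>z. interior1 X \<theta> (chart_inv c z))"
    by (rule smooth_on_cong[OF smooth_on_inner[OF op form_coeffs_smooth[OF assms(1) c assms(3)]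
            field_coeffs_smooth[OF assms(2) c]] op])
      (simp add: interior1_chart[OF assms(1,2) c])
qed

text \<open>The term \<open>D a (snd c p) u \<bullet> \<sigma> (snd c p)\<close> enters i_X
  d\<theta> with a minus sign and d(\<theta>(X)) with a plus sign, so it cancels in Cartan's
  formula.\<close>

lemma lie_deriv_chart:
  assumes \<theta>: "one_form B W \<theta>" and X: "vector_field B W X" and W: "opn W"
    and c: "c \<in> B" and p: "p \<in> W" "p \<in> fst c"
  defines "a \<equiv> form_coeffs B c \<theta>" and "\<sigma> \<equiv> field_coeffs c X"
  shows "differential (interior1 X \<theta>) p (tangent B c p u) = D (\<lambda>z. a z \<bullet> \<sigma> z) (snd c p) u"
    and "D (\<lambda>z. a z \<bullet> \<sigma> z) (snd c p) u = a (snd c p) \<bullet> D \<sigma> (snd c p) u + D a (snd c p) u \<bullet> \<sigma> (snd c p)"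
    and "lie_deriv B X \<theta> p (tangent B c p u) =
      D a (snd c p) (\<sigma> (snd c p)) \<bullet> u + a (snd c p) \<bullet> D \<sigma> (snd c p) u"
proof -
  let ?z = "snd c p"
  have z: "?z \<in> snd c ` (W \<inter> fst c)" using p by blast
  have as: "smooth_on (snd c ` (W \<inter> fst c)) a"
    unfolding a_def by (rule form_coeffs_smooth[OF \<theta> c W])
  have ss: "smooth_on (snd c ` (W \<inter> fst c)) \<sigma>"
    unfolding \<sigma>_def by (rule field_coeffs_smooth[OF X c])
  note d = smooth_on_differentiable[OF as z] smooth_on_differentiable[OF ss z]
  have "D (\<lambda>z. a z \<bullet> \<sigma> z) ?z = D (\<lambda>z. interior1 X \<theta> (chart_inv c z)) ?z"
    by (rule D_cong[OF open_chart_image[OF W c] z])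
      (auto simp: interior1_chart[OF \<theta> X c] a_def \<sigma>_def
         intro!: differentiable_bilinear[OF bounded_bilinear_inner] d[unfolded a_def \<sigma>_def])
  then show 1: "differential (interior1 X \<theta>) p (tangent B c p u) = D (\<lambda>z. a z \<bullet> \<sigma> z) ?z u"
    unfolding differential_def
    using tangent_smooth[OF smooth_nearI[OF W p(1) smooth_interior1[OF \<theta> X W]]] by simp
  show 2: "D (\<lambda>z. a z \<bullet> \<sigma> z) ?z u = a ?z \<bullet> D \<sigma> ?z u + D a ?z u \<bullet> \<sigma> ?z"
    by (rule D_inner[OF d])
  have "interior2 X (ext_deriv B \<theta>) p (tangent B c p u) = D a ?z (\<sigma> ?z) \<bullet> u - D a ?z u \<bullet> \<sigma> ?z"
    unfolding interior2_def field_coeffs_tangent[OF X c p] a_def \<sigma>_def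
    by (rule ext_deriv_chart[OF \<theta> W c p])
  then show "lie_deriv B X \<theta> p (tangent B c p u) = D a ?z (\<sigma> ?z) \<bullet> u + a ?z \<bullet> D \<sigma> ?z u"
    unfolding lie_deriv_def 1 2 by simp
qed

lemma one_form_lie_deriv:
  assumes \<theta>: "one_form B W \<theta>" and X: "vector_field B W X" and W: "opn W"
  shows "one_form B W (lie_deriv B X \<theta>)"
  unfolding one_form_def
proof (intro ballI conjI allI)
  fix c assume c: "c \<in> B"
  define a where "a = form_coeffs B c \<theta>"
  define \<sigma> where "\<sigma> = field_coeffs c X"
  let ?U = "snd c ` (W \<inter> fst c)"
  have U: "open ?U" by (rule open_chart_image[OF W c])
  have as: "smooth_on ?U a"
    unfolding a_def by (rule form_coeffs_smooth[OF \<theta> c W])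
  have ss: "smooth_on ?U \<sigma>"
    unfolding \<sigma>_def by (rule field_coeffs_smooth[OF X c])
  have eq: "in_chart B c (lie_deriv B X \<theta>) z u = D a z (\<sigma> z) \<bullet> u + a z \<bullet> D \<sigma> z u" if "z \<in> ?U" for z u
    using that lie_deriv_chart(3)[OF \<theta> X W c, of _ u] form_at_tangent[OF c, of _ "lie_deriv B X \<theta>" u]
    unfolding a_def \<sigma>_def by auto
  show "linear (in_chart B c (lie_deriv B X \<theta>) z)" if z: "z \<in> ?U" for z
    using linear_D[OF smooth_on_differentiable[OF ss z]]
    by (auto intro!: linearI simp: eq[OF z] linear_add linear_scale inner_add_right algebra_simps)
  show "smooth_on ?U (\<lambda>z. in_chart B c (lie_deriv B X \<theta>) z u)" for u
    by (rule smooth_on_cong[OF smooth_on_add[OF U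
            smooth_on_bounded_linear[OF bounded_linear_inner_left U smooth_on_D_apply[OF U as ss]]
            smooth_on_inner[OF U as smooth_on_D[OF ss]]] U])
      (simp add: eq)
qed

text \<open>Forms are arbitrary functions off the tangent spaces, so 2-forms can be compared on
  tangent vectors only; \<open>rank2\<close> evaluates them nowhere else.\<close>

lemma rank2_cong:
  assumes "p \<in> points B"
    and "\<And>v w. \<lbrakk>v \<in> tangent_space B p; w \<in> tangent_space B p\<rbrakk> \<Longrightarrow> \<omega> p v w = \<omega>' p v w"
  shows "rank2 B p \<omega> = rank2 B p \<omega>'"
  unfolding rank2_def Let_def
  using assms(2)[OF tangent_in_space tangent_in_space] chart_at_props[OF assms(1)] by simp

end

section \<open>The jet atlas\<close>

lemma smooth_manifold_atlas: "smooth_manifold A \<Longrightarrow> compatible_atlas A"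
  unfolding smooth_manifold_def by unfold_locales auto

text \<open>Adapted charts are taken from the maximal atlas and may be missing from A, so the chart
  calculus is needed there too.\<close>

locale maximal = compatible_atlas A for A :: "('p, 'e::euclidean_space) atlas"
begin

abbreviation M :: "('p, 'e) atlas" where "M \<equiv> maximal_atlas A"

section \<open>Charts of the maximal atlas\<close>

lemma max_chart: "c \<in> M \<Longrightarrow> is_chart c" "c \<in> M \<Longrightarrow> fst c \<subseteq> points A"
  and max_compat: "c \<in> M \<Longrightarrow> d \<in> A \<Longrightarrow> compatible c d"
  by (auto simp: maximal_atlas_def)

lemma atlas_subset_maximal: "A \<subseteq> M"
  using charts compat by (auto simp: maximal_atlas_def points_def)

text \<open>Charts of M are by definition compatible with those of A. Near each point of the overlap
  the transition map factors through a chart of A, and openness and smoothness are local.\<close>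

lemma maximal_transition:
  assumes c: "c \<in> M" and d: "d \<in> M"
  shows "open (snd c ` (fst c \<inter> fst d))"
    and "smooth_on (snd c ` (fst c \<inter> fst d)) (\<lambda>z. snd d (chart_inv c z))"
proof -
  have *: "\<exists>V. open V \<and> z \<in> V \<and> V \<subseteq> snd c ` (fst c \<inter> fst d) \<and> smooth_on V (\<lambda>z. snd d (chart_inv c z))"
    if z: "z \<in> snd c ` (fst c \<inter> fst d)" for z
  proof -
    obtain p where p: "p \<in> fst c" "p \<in> fst d" "z = snd c p" using z by blast
    obtain a where a: "a \<in> A" "p \<in> fst a"
      using max_chart(2)[OF c] p(1) by (auto simp: points_def)
    have ca: "open (snd c ` (fst c \<inter> fst a))" "smooth_on (snd c ` (fst c \<inter> fst a)) (\<lambda>z. snd a (chart_inv c z))"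
      and ad: "open (snd a ` (fst d \<inter> fst a))" "smooth_on (snd a ` (fst d \<inter> fst a)) (\<lambda>z. snd d (chart_inv a z))"
      using max_compat[OF c a(1)] max_compat[OF d a(1)] unfolding compatible_def o_def by auto
    define V where "V = snd c ` (fst c \<inter> fst a \<inter> fst d)"
    \<comment> \<open>V is exhibited as the preimage of an open set under a map continuous on an
      open set, which makes it open.\<close>
    have "V = snd c ` (fst c \<inter> fst a) \<inter> (\<lambda>z. snd a (chart_inv c z)) -` (snd a ` (fst d \<inter> fst a))"
    proof (intro subset_antisym subsetI)
      fix y assume "y \<in> snd c ` (fst c \<inter> fst a) \<inter> (\<lambda>z. snd a (chart_inv c z)) -` (snd a ` (fst d \<inter> fst a))"
      then obtain q r where q: "q \<in> fst c" "q \<in> fst a" "y = snd c q"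
        and r: "r \<in> fst d" "r \<in> fst a" "snd a (chart_inv c y) = snd a r" by auto
      then have "q = r"
        using chart_inv_chart[OF max_chart(1)[OF c] q(1)] inv_chart[OF a(1)] by metis
      then show "y \<in> V" using q r by (auto simp: V_def)
    qed (auto simp: V_def chart_inv_chart[OF max_chart(1)[OF c]])
    then have V: "open V"
      using ca ad by (metis Int_commute continuous_on_open_vimage smooth_on_continuous_on)
    have "smooth_on V (\<lambda>z. snd d (chart_inv a (snd a (chart_inv c z))))"
      by (rule smooth_on_compose[OF V smooth_on_subset[OF ca(2)] ad(2)])
        (auto simp: V_def chart_inv_chart[OF max_chart(1)[OF c]])
    then have "smooth_on V (\<lambda>z. snd d (chart_inv c z))"
      by (rule smooth_on_cong[OF _ V])
        (auto simp: V_def chart_inv_chart[OF max_chart(1)[OF c]] inv_chart[OF a(1)])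
    then show ?thesis
      using V p a by (intro exI[of _ V]) (auto simp: V_def)
  qed
  show "open (snd c ` (fst c \<inter> fst d))"
    unfolding open_subopen[of "snd c ` (fst c \<inter> fst d)"] using * by blast
  show "smooth_on (snd c ` (fst c \<inter> fst d)) (\<lambda>z. snd d (chart_inv c z))"
    by (rule smooth_on_local) (use * in blast)
qed

lemma maximal_atlas_compatible: "compatible_atlas M"
proof
  show "is_chart c" if "c \<in> M" for c
    by (rule max_chart(1)[OF that])
  show "compatible c d" if "c \<in> M" "d \<in> M" for c d
    using maximal_transition[OF that] maximal_transition[OF that(2,1)]
    unfolding compatible_def by (simp add: o_def Int_commute)
qed

text \<open>Smoothness is meant with respect to A, not M: \<open>vertical\<close> pushes tangent
  vectors to functionals on functions smooth for A, and coordinates of adapted charts will be the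
  test functions.\<close>

lemma smooth_near_maximal_coordinate:
  assumes c: "c \<in> M" and p: "p \<in> fst c"
  shows "smooth_near A p (\<lambda>q. snd c q \<bullet> b)"
proof (rule smooth_nearI)
  show "opn (fst c)"
    unfolding openin_subopen[of _ "fst c"]
  proof
    fix q assume q: "q \<in> fst c"
    obtain a where a: "a \<in> A" "q \<in> fst a"
      using max_chart(2)[OF c] q by (auto simp: points_def)
    have "fst a \<inter> snd a -` (snd a ` (fst c \<inter> fst a)) \<subseteq> fst c"
      by (auto dest: chart_eqD[OF _ charts[OF a(1)]])
    moreover have "opn (fst a \<inter> snd a -` (snd a ` (fst c \<inter> fst a)))"
      by (rule opn_chart_preimage[OF a(1)]) (use max_compat[OF c a(1)] in \<open>auto simp: compatible_def\<close>)
    ultimately show "\<exists>T. opn T \<and> q \<in> T \<and> T \<subseteq> fst c"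
      using a q by (intro exI[of _ "fst a \<inter> snd a -` (snd a ` (fst c \<inter> fst a))"]) auto
  qed
  show "p \<in> fst c" by fact
  show "smooth_fun A (fst c) (\<lambda>q. snd c q \<bullet> b)"
    unfolding smooth_fun_def o_def
  proof
    fix a assume "a \<in> A"
    then have "open (snd a ` (fst c \<inter> fst a))" "smooth_on (snd a ` (fst c \<inter> fst a)) (\<lambda>z. snd c (chart_inv a z))"
      using max_compat[OF c] unfolding compatible_def o_def by auto
    then show "smooth_on (snd a ` (fst c \<inter> fst a)) (\<lambda>z. snd c (chart_inv a z) \<bullet> b)"
      by (rule smooth_on_bounded_linear[OF bounded_linear_inner_left])
  qed
qed

end

sublocale maximal \<subseteq> M: compatible_atlas "maximal_atlas A"
  by (rule maximal_atlas_compatible)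

definition velocity :: "('p, 'e::euclidean_space) chart \<Rightarrow> (real \<Rightarrow> 'p) \<Rightarrow> real \<Rightarrow> 'e" where
  "velocity c \<gamma> t = vector_derivative (snd c \<circ> \<gamma>) (at t)"

locale jets =
  fixes A :: "('m, real \<times> (real ^ 'n)) atlas" and \<pi> :: "'m \<Rightarrow> real"
  assumes fibred: "fibred_manifold A \<pi>"

sublocale jets \<subseteq> maximal A
  using fibred smooth_manifold_atlas unfolding fibred_manifold_def maximal_def by blast

context jets
begin

abbreviation "FC \<equiv> fibred_charts A \<pi>"
abbreviation "JA \<equiv> jet_atlas A \<pi>"
abbreviation "jc \<equiv> jet_chart A \<pi>"

section \<open>Sections, velocities and jets in adapted charts\<close>

lemma FC_max: "c \<in> FC \<Longrightarrow> c \<in> M"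
  and FC_fst: "c \<in> FC \<Longrightarrow> p \<in> fst c \<Longrightarrow> fst (snd c p) = \<pi> p"
  by (auto simp: fibred_charts_def)

text \<open>Curves are smooth by definition in charts of A. To reach a chart c of M, the section is
  read in a chart a of A and then composed with the transition map.\<close>

lemma section_near:
  assumes \<gamma>: "local_section A \<pi> t \<gamma>" and c: "c \<in> M" "\<gamma> t \<in> fst c"
  obtains N where "open N" "t \<in> N" "\<gamma> ` N \<subseteq> fst c" "smooth_on N (snd c \<circ> \<gamma>)"
    "\<forall>s\<in>N. \<pi> (\<gamma> s) = s"
proof -
  obtain I where I: "open I" "t \<in> I" "smooth_curve_on A I \<gamma>" "\<And>s. s \<in> I \<Longrightarrow> \<pi> (\<gamma> s) = s"
    using \<gamma> unfolding local_section_def by blast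
  then have "\<gamma> t \<in> points A"
    unfolding smooth_curve_on_def by blast
  then obtain a where a: "a \<in> A" "\<gamma> t \<in> fst a" by (auto simp: points_def)
  then have "\<exists>N. open N \<and> t \<in> N \<and> N \<subseteq> I \<and> \<gamma> ` N \<subseteq> fst a \<and> smooth_on N (snd a \<circ> \<gamma>)"
    using I(2,3) unfolding smooth_curve_on_def by blast
  then obtain N0 where N0: "open N0" "t \<in> N0" "N0 \<subseteq> I" "\<gamma> ` N0 \<subseteq> fst a" "smooth_on N0 (snd a \<circ> \<gamma>)" by blast
  have aM: "a \<in> M" using a atlas_subset_maximal by blast
  note tr = maximal_transition[OF aM c(1)]
  define N where "N = (snd a \<circ> \<gamma>) -` (snd a ` (fst a \<inter> fst c)) \<inter> N0"
  have N: "open N"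
    unfolding N_def
    by (rule continuous_on_open_vimage[OF N0(1), THEN iffD1, rule_format,
          OF smooth_on_continuous_on[OF N0(5)] tr(1)])
  have Nc: "\<gamma> s \<in> fst c" "\<gamma> s \<in> fst a" if "s \<in> N" for s
  proof -
    have sa: "\<gamma> s \<in> fst a" using that N0(4) by (auto simp: N_def)
    then show "\<gamma> s \<in> fst a" .
    obtain q where "q \<in> fst a" "q \<in> fst c" "snd a (\<gamma> s) = snd a q"
      using \<open>s \<in> N\<close> by (auto simp: N_def)
    then show "\<gamma> s \<in> fst c" using chart_eqD[OF _ charts[OF a(1)]] sa by blast
  qed
  have "smooth_on N (\<lambda>s. snd c (chart_inv a ((snd a \<circ> \<gamma>) s)))"
    by (rule smooth_on_compose[OF N smooth_on_subset[OF N0(5)] tr(2)]) (auto simp: N_def)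
  then have "smooth_on N (snd c \<circ> \<gamma>)"
    by (rule smooth_on_cong[OF _ N]) (simp add: inv_chart[OF a(1) Nc(2)])
  moreover have "t \<in> N"
    using N0(2) a(2) c(2) by (simp add: N_def)
  moreover have "\<gamma> ` N \<subseteq> fst c"
    using Nc(1) by blast
  moreover have "\<forall>s\<in>N. \<pi> (\<gamma> s) = s"
    using N0(3) I(4) by (auto simp: N_def)
  ultimately show thesis
    using N by (intro that)
qed

lemma section_differentiable:
  assumes "local_section A \<pi> t \<gamma>" "c \<in> M" "\<gamma> t \<in> fst c"
  shows "(snd c \<circ> \<gamma>) differentiable (at t)"
  by (rule section_near[OF assms]) (rule smooth_on_differentiable)

lemma velocity_change:
  assumes \<gamma>: "local_section A \<pi> t \<gamma>" and c: "c \<in> M" "\<gamma> t \<in> fst c" and d: "d \<in> M" "\<gamma> t \<in> fst d"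
  shows "velocity d \<gamma> t = D (\<lambda>z. snd d (chart_inv c z)) (snd c (\<gamma> t)) (velocity c \<gamma> t)"
proof -
  obtain N where N: "open N" "t \<in> N" "\<gamma> ` N \<subseteq> fst c"
    by (rule section_near[OF \<gamma> c])
  have td: "(\<lambda>z. snd d (chart_inv c z)) differentiable (at (snd c (\<gamma> t)))"
    by (rule smooth_on_differentiable[OF maximal_transition(2)[OF c(1) d(1)]]) (use c d in blast)
  have "velocity d \<gamma> t = vector_derivative (\<lambda>s. snd d (chart_inv c ((snd c \<circ> \<gamma>) s))) (at t)"
    unfolding velocity_def
  proof (rule vector_derivative_cong_eq)
    show "\<forall>\<^sub>F s in nhds t. s \<in> UNIV \<longrightarrow> (snd d \<circ> \<gamma>) s = snd d (chart_inv c ((snd c \<circ> \<gamma>) s))"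
      using eventually_nhds_in_open[OF N(1,2)]
      by eventually_elim (use N(3) M.inv_chart[OF c(1)] in auto)
  qed auto
  also have "\<dots> = D (\<lambda>z. snd d (chart_inv c z)) ((snd c \<circ> \<gamma>) t) (velocity c \<gamma> t)"
    unfolding velocity_def
    by (rule vector_derivative_compose[OF section_differentiable[OF \<gamma> c]]) (simp add: td)
  finally show ?thesis by simp
qed

text \<open>The first coordinate of an adapted chart is \<pi>, and \<pi> recovers the parameter of a
  section. So the velocity is (1, y), and only y carries information.\<close>

lemma section_coordinates:
  assumes \<gamma>: "local_section A \<pi> t \<gamma>" and c: "c \<in> FC" "\<gamma> t \<in> fst c"
  shows "fst (snd c (\<gamma> t)) = t" "fst (velocity c \<gamma> t) = 1"
    "snd (velocity c \<gamma> t) = vector_derivative (\<lambda>s. snd (snd c (\<gamma> s))) (at t)"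
proof -
  obtain N where N: "open N" "t \<in> N" "\<gamma> ` N \<subseteq> fst c" "smooth_on N (snd c \<circ> \<gamma>)"
    "\<forall>s\<in>N. \<pi> (\<gamma> s) = s"
    by (rule section_near[OF \<gamma> FC_max[OF c(1)] c(2)])
  then have t: "fst (snd c (\<gamma> s)) = s" if "s \<in> N" for s
    using FC_fst[OF c(1)] that by auto
  then show "fst (snd c (\<gamma> t)) = t" using N by simp
  have v: "((snd c \<circ> \<gamma>) has_vector_derivative velocity c \<gamma> t) (at t)"
    unfolding velocity_def
    using section_differentiable[OF \<gamma> FC_max[OF c(1)] c(2)] by (simp add: vector_derivative_works)
  have "((\<lambda>s. fst ((snd c \<circ> \<gamma>) s)) has_vector_derivative fst (velocity c \<gamma> t)) (at t)"
    by (rule bounded_linear.has_vector_derivative[OF bounded_linear_fst v])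
  then have "((\<lambda>s. s) has_vector_derivative fst (velocity c \<gamma> t)) (at t)"
    by (rule has_vector_derivative_transform_within_open[OF _ N(1,2)]) (simp add: t)
  then show "fst (velocity c \<gamma> t) = 1"
    by (rule vector_derivative_unique_at[OF _ has_vector_derivative_id])
  have "((\<lambda>s. snd ((snd c \<circ> \<gamma>) s)) has_vector_derivative snd (velocity c \<gamma> t)) (at t)"
    by (rule bounded_linear.has_vector_derivative[OF bounded_linear_snd v])
  then show "snd (velocity c \<gamma> t) = vector_derivative (\<lambda>s. snd (snd c (\<gamma> s))) (at t)"
    by (simp add: vector_derivative_at o_def)
qed

text \<open>\<open>jet\<close> compares velocities in every chart of A; they transform by the
  derivative of the transition map, so agreement in one chart is enough.\<close>

lemma jet_eqI:
  assumes \<gamma>: "local_section A \<pi> t \<gamma>" and \<sigma>: "local_section A \<pi> t \<sigma>" and eq: "\<sigma> t = \<gamma> t"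
    and c: "c \<in> M" "\<gamma> t \<in> fst c" and vel: "velocity c \<sigma> t = velocity c \<gamma> t"
  shows "jet A \<pi> t \<sigma> = jet A \<pi> t \<gamma>"
proof -
  have "velocity a \<sigma> t = velocity a \<gamma> t" if "a \<in> A" "\<gamma> t \<in> fst a" for a
  proof -
    have "a \<in> M" using that atlas_subset_maximal by blast
    then show ?thesis
      using velocity_change[OF \<gamma> c _ that(2)] velocity_change[OF \<sigma> c(1)] eq c that vel by simp
  qed
  then show ?thesis
    unfolding jet_def velocity_def using eq by auto
qed

text \<open>\<open>jet_rep\<close> picks an unspecified section from a class that contains \<gamma>.
  Equality of velocities is part of the class for charts of A and reaches charts of M by
  \<open>velocity_change\<close>.\<close>

lemma jet_rep:
  assumes \<gamma>: "local_section A \<pi> t \<gamma>"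
  defines "\<sigma> \<equiv> jet_rep (jet A \<pi> t \<gamma>)"
  shows "local_section A \<pi> t \<sigma>" "\<sigma> t = \<gamma> t"
    and "\<And>c. c \<in> M \<Longrightarrow> \<gamma> t \<in> fst c \<Longrightarrow> velocity c \<sigma> t = velocity c \<gamma> t"
proof -
  have "\<gamma> \<in> snd (jet A \<pi> t \<gamma>)" using \<gamma> by (simp add: jet_def)
  then have "\<sigma> \<in> snd (jet A \<pi> t \<gamma>)" unfolding \<sigma>_def jet_rep_def
    by (rule someI[of "\<lambda>x. x \<in> snd (jet A \<pi> t \<gamma>)"])
  then show \<sigma>: "local_section A \<pi> t \<sigma>" "\<sigma> t = \<gamma> t"
    by (auto simp: jet_def)
  have *: "\<And>a. a \<in> A \<Longrightarrow> \<gamma> t \<in> fst a \<Longrightarrow> velocity a \<sigma> t = velocity a \<gamma> t"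
    using \<open>\<sigma> \<in> snd (jet A \<pi> t \<gamma>)\<close> by (auto simp: jet_def velocity_def)
  fix c assume c: "c \<in> M" "\<gamma> t \<in> fst c"
  obtain a where a: "a \<in> A" "\<gamma> t \<in> fst a"
    using max_chart(2)[OF c(1)] c(2) by (auto simp: points_def)
  then have aM: "a \<in> M" using atlas_subset_maximal by blast
  show "velocity c \<sigma> t = velocity c \<gamma> t"
    using velocity_change[OF \<gamma> aM a(2) c] velocity_change[OF \<sigma>(1) aM _ c(1)] \<sigma>(2) *[OF a] a(2) c(2) by simp
qed

lemma fst_jet: "fst (jet A \<pi> t \<gamma>) = t"
  by (simp add: jet_def)

lemma pi10_jet: "local_section A \<pi> t \<gamma> \<Longrightarrow> pi10 (jet A \<pi> t \<gamma>) = \<gamma> t"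
  unfolding pi10_def fst_jet by (rule jet_rep(2))

lemma J1E:
  assumes "j \<in> J1 A \<pi>"
  obtains t \<gamma> where "local_section A \<pi> t \<gamma>" "j = jet A \<pi> t \<gamma>" "pi10 j = \<gamma> t"
  using assms pi10_jet unfolding J1_def by blast

lemma jet_in_J1: "local_section A \<pi> t \<gamma> \<Longrightarrow> jet A \<pi> t \<gamma> \<in> J1 A \<pi>"
  unfolding J1_def by blast

section \<open>Charts of the jet bundle and their transition maps\<close>

lemma fst_jc: "fst (jc c) = {j \<in> J1 A \<pi>. pi10 j \<in> fst c}"
  by (simp add: jet_chart_def)

lemma jc_jet:
  assumes \<gamma>: "local_section A \<pi> t \<gamma>" and c: "c \<in> FC" "\<gamma> t \<in> fst c"
  shows "snd (jc c) (jet A \<pi> t \<gamma>) = (t, snd (snd c (\<gamma> t)), snd (velocity c \<gamma> t))"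
proof -
  let ?\<sigma> = "jet_rep (jet A \<pi> t \<gamma>)"
  note \<sigma> = jet_rep[OF \<gamma>]
  have "snd (velocity c ?\<sigma> t) = vector_derivative (\<lambda>s. snd (snd c (?\<sigma> s))) (at t)"
    by (rule section_coordinates(3)[OF \<sigma>(1) c(1)]) (simp add: \<sigma>(2) c(2))
  then show ?thesis
    using \<sigma>(3)[OF FC_max[OF c(1)] c(2)]
    by (simp add: jet_chart_def fst_jet pi10_jet[OF \<gamma>])
qed

lemma jc_jetE:
  assumes c: "c \<in> FC" and j: "j \<in> fst (jc c)" and xy: "snd (jc c) j = (t, x, y)"
  obtains \<gamma> where "local_section A \<pi> t \<gamma>" "j = jet A \<pi> t \<gamma>" "pi10 j = \<gamma> t" "\<gamma> t \<in> fst c"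
    "snd c (\<gamma> t) = (t, x)" "velocity c \<gamma> t = (1, y)"
proof -
  obtain t' \<gamma> where \<gamma>: "local_section A \<pi> t' \<gamma>" "j = jet A \<pi> t' \<gamma>" "pi10 j = \<gamma> t'"
    using j by (auto simp: fst_jc elim: J1E)
  then have c': "\<gamma> t' \<in> fst c" using j by (simp add: fst_jc)
  note s = section_coordinates[OF \<gamma>(1) c c']
  have t': "t' = t" and xy': "snd (snd c (\<gamma> t')) = x" "snd (velocity c \<gamma> t') = y"
    using jc_jet[OF \<gamma>(1) c c'] xy unfolding \<gamma>(2) by simp_all
  show thesis
  proof (rule that)
    show "snd c (\<gamma> t) = (t, x)" "velocity c \<gamma> t = (1, y)"
      using s(1,2) xy' unfolding t' by (simp_all add: prod_eq_iff)
  qed (use \<gamma> c' in \<open>simp_all only: t'\<close>)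
qed

lemma jc_inj: "c \<in> FC \<Longrightarrow> inj_on (snd (jc c)) (fst (jc c))"
proof (rule inj_onI)
  fix j j' assume c: "c \<in> FC" and j: "j \<in> fst (jc c)" "j' \<in> fst (jc c)"
    and eq: "snd (jc c) j = snd (jc c) j'"
  obtain t x y where xy: "snd (jc c) j = (t, x, y)" by (rule prod_cases3)
  obtain \<gamma> where \<gamma>: "local_section A \<pi> t \<gamma>" "j = jet A \<pi> t \<gamma>" "pi10 j = \<gamma> t" "\<gamma> t \<in> fst c"
    "snd c (\<gamma> t) = (t, x)" "velocity c \<gamma> t = (1, y)"
    by (rule jc_jetE[OF c j(1) xy])
  obtain \<sigma> where \<sigma>: "local_section A \<pi> t \<sigma>" "j' = jet A \<pi> t \<sigma>" "pi10 j' = \<sigma> t" "\<sigma> t \<in> fst c"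
    "snd c (\<sigma> t) = (t, x)" "velocity c \<sigma> t = (1, y)"
    by (rule jc_jetE[OF c j(2) xy[unfolded eq]])
  have "\<gamma> t = \<sigma> t"
    by (rule chart_eqD[OF _ M.charts[OF FC_max[OF c]] \<gamma>(4) \<sigma>(4)]) (simp add: \<gamma>(5) \<sigma>(5))
  then show "j = j'"
    using jet_eqI[OF \<sigma>(1) \<gamma>(1) _ FC_max[OF c] \<sigma>(4)] \<gamma>(2,6) \<sigma>(2,6) by simp
qed

text \<open>A straight line in coordinates realises any prescribed jet coordinates (t, x, y) over
  the chart; it determines the images of the jet charts.\<close>

lemma line_section:
  fixes y :: "real ^ 'n"
  assumes c: "c \<in> FC" and tx: "(t, x) \<in> snd c ` fst c"
  defines "\<gamma> \<equiv> \<lambda>s. chart_inv c (s, x + (s - t) *\<^sub>R y)"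
  shows "local_section A \<pi> t \<gamma>" "\<gamma> t \<in> fst c" "snd c (\<gamma> t) = (t, x)" "velocity c \<gamma> t = (1, y)"
proof -
  define l where "l s = (s, x + (s - t) *\<^sub>R y)" for s :: real
  \<comment> \<open>The parameters at which the line is still in the chart image; elsewhere
    \<open>chart_inv\<close> is arbitrary.\<close>
  define I where "I = l -` (snd c ` fst c)"
  have cM: "c \<in> M" by (rule FC_max[OF c])
  have ls: "smooth_on UNIV l"
    unfolding l_def
    by (intro smooth_on_Pair smooth_on_add smooth_on_scaleR smooth_on_diff smooth_on_ident smooth_on_const open_UNIV)
  have lc: "continuous_on UNIV l" by (rule smooth_on_continuous_on[OF ls])
  have I: "open I" "t \<in> I"
    using tx open_vimage[OF _ lc] max_chart(1)[OF cM] by (auto simp: I_def l_def is_chart_def)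
  have \<gamma>l: "\<gamma> s = chart_inv c (l s)" for s by (simp add: \<gamma>_def l_def)
  have \<gamma>c: "\<gamma> s \<in> fst c" "snd c (\<gamma> s) = l s" if "s \<in> I" for s
    using that chart_inv_in[of "l s" c "fst c"] chart_of_inv[of "l s" c "fst c"]
    by (auto simp: \<gamma>l I_def)
  show "\<gamma> t \<in> fst c" "snd c (\<gamma> t) = (t, x)"
    using \<gamma>c[OF I(2)] by (auto simp: l_def)
  have "smooth_curve_on A I \<gamma>"
    unfolding smooth_curve_on_def
  proof (intro conjI ballI impI)
    show "\<gamma> ` I \<subseteq> points A"
      using \<gamma>c max_chart(2)[OF cM] by blast
    fix a s assume a: "a \<in> A" and s: "s \<in> I" "\<gamma> s \<in> fst a"
    have aM: "a \<in> M" using a atlas_subset_maximal by blast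
    note tr = maximal_transition[OF cM aM]
    define N where "N = l -` (snd c ` (fst c \<inter> fst a))"
    have N: "open N" unfolding N_def by (rule open_vimage[OF tr(1) lc])
    have "smooth_on N (\<lambda>s. snd a (chart_inv c (l s)))"
      by (rule smooth_on_compose[OF N smooth_on_subset[OF ls] tr(2)]) (auto simp: N_def)
    moreover have "s \<in> N"
      using \<gamma>c[OF s(1)] s(2) by (auto simp: N_def image_iff intro: bexI[of _ "\<gamma> s"])
    moreover have "\<gamma> ` N \<subseteq> fst a"
      by (auto simp: N_def \<gamma>l M.inv_chart[OF cM])
    ultimately show "\<exists>N. open N \<and> s \<in> N \<and> N \<subseteq> I \<and> \<gamma> ` N \<subseteq> fst a \<and> smooth_on N (snd a \<circ> \<gamma>)"
      using N by (intro exI[of _ N]) (auto simp: N_def I_def \<gamma>l o_def)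
  qed
  moreover have "\<pi> (\<gamma> s) = s" if "s \<in> I" for s
    using FC_fst[OF c \<gamma>c(1)[OF that]] \<gamma>c(2)[OF that] by (simp add: l_def)
  ultimately show "local_section A \<pi> t \<gamma>"
    unfolding local_section_def using I by blast
  have "(l has_vector_derivative (1, y)) (at t)"
    unfolding l_def by (auto intro!: derivative_eq_intros)
  then have "((snd c \<circ> \<gamma>) has_vector_derivative (1, y)) (at t)"
    by (rule has_vector_derivative_transform_within_open[OF _ I]) (simp add: \<gamma>c)
  then show "velocity c \<gamma> t = (1, y)"
    unfolding velocity_def by (rule vector_derivative_at)
qed

text \<open>Every velocity y occurs over every point, so the images are cylinders. The set X is
  general in order to cover both domains and overlaps of jet charts.\<close>

lemma jc_image:
  assumes c: "c \<in> FC" and X: "X \<subseteq> fst c"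
  shows "snd (jc c) ` {j \<in> J1 A \<pi>. pi10 j \<in> X} = {(t, x, y). (t, x) \<in> snd c ` X}"
proof (intro subset_antisym subsetI)
  fix z assume "z \<in> snd (jc c) ` {j \<in> J1 A \<pi>. pi10 j \<in> X}"
  then obtain j where j: "j \<in> J1 A \<pi>" "pi10 j \<in> X" "z = snd (jc c) j" by blast
  obtain t x y where xy: "snd (jc c) j = (t, x, y)" by (rule prod_cases3)
  obtain \<gamma> where "pi10 j = \<gamma> t" "snd c (\<gamma> t) = (t, x)"
    by (rule jc_jetE[OF c _ xy]) (use j X in \<open>auto simp: fst_jc\<close>)
  with j xy show "z \<in> {(t, x, y). (t, x) \<in> snd c ` X}"
    by (auto simp: image_iff intro!: bexI[of _ "pi10 j"])
next
  fix z :: "real \<times> (real ^ 'n) \<times> (real ^ 'n)"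
  assume "z \<in> {(t, x, y). (t, x) \<in> snd c ` X}"
  then obtain t x y where z: "z = (t, x, y)" "(t, x) \<in> snd c ` X" by blast
  define \<gamma> where "\<gamma> = (\<lambda>s. chart_inv c (s, x + (s - t) *\<^sub>R y))"
  have tx: "(t, x) \<in> snd c ` fst c" using z X by blast
  have l: "local_section A \<pi> t \<gamma>" "\<gamma> t \<in> fst c" "snd c (\<gamma> t) = (t, x)" "velocity c \<gamma> t = (1, y)"
    unfolding \<gamma>_def by (rule line_section[OF c tx])+
  have "\<gamma> t \<in> X"
    using chart_inv_in_subset[OF max_chart(1)[OF FC_max[OF c]] z(2) X] by (simp add: \<gamma>_def)
  then have "jet A \<pi> t \<gamma> \<in> {j \<in> J1 A \<pi>. pi10 j \<in> X}"
    using jet_in_J1[OF l(1)] pi10_jet[OF l(1)] by simp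
  moreover have "z = snd (jc c) (jet A \<pi> t \<gamma>)"
    using jc_jet[OF l(1) c l(2)] l(3,4) z(1) by simp
  ultimately show "z \<in> snd (jc c) ` {j \<in> J1 A \<pi>. pi10 j \<in> X}" by blast
qed

lemma open_jet_cylinder:
  fixes V :: "(real \<times> (real ^ 'n)) set"
  assumes "open V"
  shows "open {(t, x, y :: real ^ 'n). (t, x) \<in> V}"
proof -
  have "{(t, x, y :: real ^ 'n). (t, x) \<in> V} = (\<lambda>z. (fst z, fst (snd z))) -` V" by auto
  moreover have "open ((\<lambda>z :: real \<times> (real ^ 'n) \<times> (real ^ 'n). (fst z, fst (snd z))) -` V)"
    by (rule open_vimage[OF assms]) (intro continuous_intros)
  ultimately show ?thesis by simp
qed

text \<open>The velocity (1, y) is transported by the derivative of T, so the new fibre coordinate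
  is the total time derivative of the new x; in particular it is affine in y.\<close>

lemma jc_transition:
  assumes c: "c \<in> FC" and d: "d \<in> FC" and j: "j \<in> fst (jc c)" "j \<in> fst (jc d)"
    and xy: "snd (jc c) j = (t, x, y)"
  defines "T \<equiv> \<lambda>z. snd d (chart_inv c z)"
  shows "snd (jc d) j = (t, snd (T (t, x)), snd (D T (t, x) (1, y)))" "fst (D T (t, x) (1, y)) = 1"
    "(t, x) \<in> snd c ` (fst c \<inter> fst d)"
proof -
  obtain \<gamma> where \<gamma>: "local_section A \<pi> t \<gamma>" "j = jet A \<pi> t \<gamma>" "pi10 j = \<gamma> t" "\<gamma> t \<in> fst c"
    "snd c (\<gamma> t) = (t, x)" "velocity c \<gamma> t = (1, y)"
    by (rule jc_jetE[OF c j(1) xy])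
  have dt: "\<gamma> t \<in> fst d" using j(2) \<gamma>(3) by (simp add: fst_jc)
  have T: "T (t, x) = snd d (\<gamma> t)"
    unfolding T_def \<gamma>(5)[symmetric] M.inv_chart[OF FC_max[OF c] \<gamma>(4)] ..
  have v: "velocity d \<gamma> t = D T (t, x) (1, y)"
    using velocity_change[OF \<gamma>(1) FC_max[OF c] \<gamma>(4) FC_max[OF d] dt] \<gamma>(5,6) by (simp add: T_def)
  show "snd (jc d) j = (t, snd (T (t, x)), snd (D T (t, x) (1, y)))"
    using jc_jet[OF \<gamma>(1) d dt] \<gamma>(2) T v by simp
  show "fst (D T (t, x) (1, y)) = 1"
    using section_coordinates(2)[OF \<gamma>(1) d dt] v by simp
  show "(t, x) \<in> snd c ` (fst c \<inter> fst d)"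
    using \<gamma>(4,5) dt by (metis IntI image_eqI)
qed

lemma jc_Int: "fst (jc c) \<inter> fst (jc d) = {j \<in> J1 A \<pi>. pi10 j \<in> fst c \<inter> fst d}"
  by (auto simp: fst_jc)

lemma jc_is_chart: "c \<in> FC \<Longrightarrow> is_chart (jc c)"
  unfolding is_chart_def
  using jc_inj jc_image[of c "fst c"] open_jet_cylinder[of "snd c ` fst c"] max_chart(1)[OF FC_max]
  by (auto simp: fst_jc is_chart_def)

lemma jc_transition_smooth:
  assumes c: "c \<in> FC" and d: "d \<in> FC"
  defines "T \<equiv> \<lambda>z. snd d (chart_inv c z)"
  defines "U \<equiv> snd (jc c) ` (fst (jc c) \<inter> fst (jc d))"
  shows "open U" and "smooth_on U (\<lambda>z. snd (jc d) (chart_inv (jc c) z))"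
    and "\<And>z. z \<in> U \<Longrightarrow> snd (jc d) (chart_inv (jc c) z) =
      (fst z, snd (T (fst z, fst (snd z))), snd (D T (fst z, fst (snd z)) (1, snd (snd z))))"
    and "\<And>z. z \<in> U \<Longrightarrow> (fst z, fst (snd z)) \<in> snd c ` (fst c \<inter> fst d)"
proof -
  note tr = maximal_transition[OF FC_max[OF c] FC_max[OF d], folded T_def]
  show U: "open U"
    unfolding U_def jc_Int
    using jc_image[OF c, of "fst c \<inter> fst d"] open_jet_cylinder[OF tr(1)] by simp
  show eq: "snd (jc d) (chart_inv (jc c) z) =
      (fst z, snd (T (fst z, fst (snd z))), snd (D T (fst z, fst (snd z)) (1, snd (snd z))))"
    and V: "(fst z, fst (snd z)) \<in> snd c ` (fst c \<inter> fst d)" if z: "z \<in> U" for z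
  proof -
    obtain j where j: "j \<in> fst (jc c)" "j \<in> fst (jc d)" "z = snd (jc c) j"
      using z unfolding U_def by blast
    then show "snd (jc d) (chart_inv (jc c) z) =
      (fst z, snd (T (fst z, fst (snd z))), snd (D T (fst z, fst (snd z)) (1, snd (snd z))))"
      "(fst z, fst (snd z)) \<in> snd c ` (fst c \<inter> fst d)"
      using jc_transition[OF c d j(1,2), of "fst z" "fst (snd z)" "snd (snd z)"]
        chart_inv_chart[OF jc_is_chart[OF c] j(1)]
      unfolding T_def by simp_all
  qed
  have tx: "smooth_on U (\<lambda>z. (fst z, fst (snd z)))"
    by (intro smooth_on_Pair smooth_on_fst smooth_on_snd smooth_on_ident U)
  have im: "(\<lambda>z. (fst z, fst (snd z))) ` U \<subseteq> snd c ` (fst c \<inter> fst d)" using V by blast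
  \<comment> \<open>The direction (1, y) varies with z, so the derivative is again expanded in basis
    directions.\<close>
  have "smooth_on U (\<lambda>z. \<Sum>b\<in>Basis. ((1, snd (snd z)) \<bullet> b) *\<^sub>R D T (fst z, fst (snd z)) b)"
    by (intro smooth_on_sum smooth_on_scaleR smooth_on_inner smooth_on_Pair smooth_on_const
        smooth_on_snd smooth_on_ident U smooth_on_compose[OF U tx smooth_on_D[OF tr(2)] im])
  then have "smooth_on U (\<lambda>z. D T (fst z, fst (snd z)) (1, snd (snd z)))"
    by (rule smooth_on_cong[OF _ U])
      (use V smooth_on_differentiable[OF tr(2)] in \<open>auto intro!: D_basis_expansion[symmetric]\<close>)
  from smooth_on_Pair[OF U smooth_on_fst[OF U smooth_on_ident[OF U]]
      smooth_on_Pair[OF U smooth_on_snd[OF U smooth_on_compose[OF U tx tr(2) im]] smooth_on_snd[OF U this]]]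
  show "smooth_on U (\<lambda>z. snd (jc d) (chart_inv (jc c) z))"
    by (rule smooth_on_cong[OF _ U]) (simp add: eq)
qed

lemma jet_atlas_compatible: "compatible_atlas JA"
proof
  show "is_chart c" if "c \<in> JA" for c
    using that jc_is_chart unfolding jet_atlas_def by blast
  fix c' d' assume "c' \<in> JA" "d' \<in> JA"
  then obtain c d where c: "c \<in> FC" "d \<in> FC" "c' = jc c" "d' = jc d"
    unfolding jet_atlas_def by blast
  show "compatible c' d'"
    unfolding c(3,4) compatible_def o_def
    using jc_transition_smooth(1,2)[OF c(1,2)] jc_transition_smooth(1,2)[OF c(2,1)]
    by (simp add: Int_commute)
qed

end

sublocale jets \<subseteq> J: compatible_atlas "jet_atlas A \<pi>"
  by (rule jet_atlas_compatible)

section \<open>Tangent vectors of the jet bundle\<close>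

context jets
begin

lemma jc_in_JA: "c \<in> FC \<Longrightarrow> jc c \<in> JA"
  unfolding jet_atlas_def by blast

lemma JA_E: "c' \<in> JA \<Longrightarrow> (\<And>c. c \<in> FC \<Longrightarrow> c' = jc c \<Longrightarrow> P) \<Longrightarrow> P"
  unfolding jet_atlas_def by blast

lemma points_JA_E:
  assumes "j \<in> points JA"
  obtains c where "c \<in> FC" "j \<in> fst (jc c)"
  using assms unfolding points_def jet_atlas_def by blast

lemma points_JA_subset: "points JA \<subseteq> J1 A \<pi>"
  by (auto elim!: points_JA_E simp: fst_jc)

text \<open>The y-row in a general direction would involve second derivatives of T. A vertical
  direction leaves (t, x) fixed, and there the new y is affine with linear part given by
  \<open>D T\<close> on (0, \<eta>); this is all that the vertical endomorphism needs.\<close>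

lemma D_jc_transition:
  assumes c: "c \<in> FC" and d: "d \<in> FC" and z: "z \<in> snd (jc c) ` (fst (jc c) \<inter> fst (jc d))"
  defines "T \<equiv> \<lambda>z. snd d (chart_inv c z)" and "\<Psi> \<equiv> \<lambda>z. snd (jc d) (chart_inv (jc c) z)"
  shows "fst (D \<Psi> z u) = fst u"
    and "fst (snd (D \<Psi> z u)) = snd (D T (fst z, fst (snd z)) (fst u, fst (snd u)))"
    and "D \<Psi> z (0, 0, \<eta>) = (0, 0, snd (D T (fst z, fst (snd z)) (0, \<eta>)))"
proof -
  note tr = maximal_transition[OF FC_max[OF c] FC_max[OF d], folded T_def]
  let ?U = "snd (jc c) ` (fst (jc c) \<inter> fst (jc d))"
  have U: "open ?U" and \<Psi>s: "smooth_on ?U \<Psi>"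
    using jc_transition_smooth(1,2)[OF c d] by (simp_all add: \<Psi>_def)
  have eq: "\<Psi> z = (fst z, snd (T (fst z, fst (snd z))), snd (D T (fst z, fst (snd z)) (1, snd (snd z))))"
    if "z \<in> ?U" for z
    using jc_transition_smooth(3)[OF c d that] unfolding T_def \<Psi>_def .
  have \<Psi>d: "\<Psi> differentiable (at z)" by (rule smooth_on_differentiable[OF \<Psi>s z])
  let ?p = "\<lambda>z :: real \<times> (real ^ 'n) \<times> (real ^ 'n). (fst z, fst (snd z))"
  have Td: "T differentiable (at (?p z))"
    by (rule smooth_on_differentiable[OF tr(2) jc_transition_smooth(4)[OF c d z]])
  note lin = linear_D[OF Td]
  have p: "bounded_linear ?p"
    by (intro bounded_linear_Pair bounded_linear_fst bounded_linear_fst_comp bounded_linear_snd)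
  have "D (\<lambda>z. fst (\<Psi> z)) z = D fst z"
    by (rule D_cong[OF U z]) (auto simp: eq intro: differentiable_bounded_linear[OF bounded_linear_fst] \<Psi>d)
  then show 1: "fst (D \<Psi> z u) = fst u" for u
    using D_compose_linear[OF bounded_linear_fst \<Psi>d, of u]
      D_eqI[OF bounded_linear_imp_has_derivative[OF bounded_linear_fst], of z] by simp
  have fs: "bounded_linear (\<lambda>z :: real \<times> (real ^ 'n) \<times> (real ^ 'n). fst (snd z))"
    using p bounded_linear_compose[OF bounded_linear_snd p] by simp
  have pd: "?p differentiable (at z)" by (rule bounded_linear_imp_differentiable[OF p])
  have Tpd: "(\<lambda>z. T (?p z)) differentiable (at z)"
    using differentiable_chain_at[OF pd Td] by (simp add: o_def)
  have "D (\<lambda>z. fst (snd (\<Psi> z))) z = D (\<lambda>z. snd (T (?p z))) z"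
    by (rule D_cong[OF U z]) (auto simp: eq intro: differentiable_bounded_linear[OF fs] \<Psi>d)
  then show 2: "fst (snd (D \<Psi> z u)) = snd (D T (?p z) (fst u, fst (snd u)))" for u
    using D_compose_linear[OF fs \<Psi>d, of u] D_compose_linear[OF bounded_linear_snd Tpd, of u]
      D_compose[OF pd Td, of u] D_eqI[OF bounded_linear_imp_has_derivative[OF p], of z] by simp
  let ?v = "(0, 0, \<eta>) :: real \<times> (real ^ 'n) \<times> (real ^ 'n)"
  have ss: "bounded_linear (\<lambda>z :: real \<times> (real ^ 'n) \<times> (real ^ 'n). snd (snd z))"
    by (intro bounded_linear_compose[OF bounded_linear_snd] bounded_linear_snd)
  have "((\<lambda>s. \<Psi> (z + s *\<^sub>R ?v)) has_vector_derivative D \<Psi> z ?v) (at 0)"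
    by (rule has_vector_derivative_line_0[OF \<Psi>d])
  from bounded_linear.has_vector_derivative[OF ss this]
  have A: "((\<lambda>s. snd (snd (\<Psi> (z + s *\<^sub>R ?v)))) has_vector_derivative snd (snd (D \<Psi> z ?v))) (at 0)" .
  have N: "open ((\<lambda>s. z + s *\<^sub>R ?v) -` ?U)" "0 \<in> (\<lambda>s. z + s *\<^sub>R ?v) -` ?U"
    using z by (auto simp only: vimage_eq scaleR_zero_left add_0_right intro!: open_vimage[OF U] continuous_intros)
  have "snd (snd (\<Psi> (z + s *\<^sub>R ?v))) = snd (D T (?p z) (1, snd (snd z))) + s *\<^sub>R snd (D T (?p z) (0, \<eta>))"
    if "s \<in> (\<lambda>s. z + s *\<^sub>R ?v) -` ?U" for s
  proof -
    have "D T (?p z) (1, snd (snd z) + s *\<^sub>R \<eta>) = D T (?p z) (1, snd (snd z)) + s *\<^sub>R D T (?p z) (0, \<eta>)"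
      using linear_add[OF lin, of "(1, snd (snd z))" "s *\<^sub>R (0, \<eta>)"] linear_scale[OF lin, of s "(0, \<eta>)"]
      by simp
    then show ?thesis using that eq[of "z + s *\<^sub>R ?v"] by simp
  qed
  from has_vector_derivative_transform_within_open[OF A N this]
  have "((\<lambda>s. snd (D T (?p z) (1, snd (snd z))) + s *\<^sub>R snd (D T (?p z) (0, \<eta>)))
      has_vector_derivative snd (snd (D \<Psi> z ?v))) (at 0)" .
  moreover have "((\<lambda>s. snd (D T (?p z) (1, snd (snd z))) + s *\<^sub>R snd (D T (?p z) (0, \<eta>)))
      has_vector_derivative snd (D T (?p z) (0, \<eta>))) (at 0)"
    by (auto intro!: derivative_eq_intros)
  ultimately have "snd (snd (D \<Psi> z ?v)) = snd (D T (?p z) (0, \<eta>))"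
    by (rule vector_derivative_unique_at)
  then show "D \<Psi> z ?v = (0, 0, snd (D T (?p z) (0, \<eta>)))"
    using 1[of ?v] 2[of ?v] linear_0[OF lin] by (simp add: prod_eq_iff zero_prod_def)
qed

text \<open>\<open>vertical_endo\<close> computes in a chosen chart. The result does not depend on
  it because the vector (0, \<delta>x) and the vertical vectors are transported by the same linear
  map, the derivative of T on vectors without time component.\<close>

lemma vertical_endo_tangent:
  assumes c: "c \<in> FC" and j: "j \<in> fst (jc c)"
  shows "vertical_endo A \<pi> j (tangent JA (jc c) j u) =
    tangent JA (jc c) j (0, 0, fst (snd u) - fst u *\<^sub>R snd (snd (snd (jc c) j)))"
proof -
  obtain d where d: "d \<in> FC" "chart_at JA j = jc d" "j \<in> fst (jc d)"
    using J.chart_at_props[OF J.chart_pointsI[OF jc_in_JA[OF c] j]] by (metis JA_E)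
  obtain t x y where z: "snd (jc c) j = (t, x, y)" by (rule prod_cases3)
  define T where "T = (\<lambda>z. snd d (chart_inv c z))"
  have zU: "(t, x, y) \<in> snd (jc c) ` (fst (jc c) \<inter> fst (jc d))"
    using j d(3) z by (metis IntI imageI)
  note D\<Psi> = D_jc_transition[OF c d(1) zU, folded T_def, simplified]
  note tr = jc_transition[OF c d(1) j d(3) z, folded T_def]
  have Td: "T differentiable (at (t, x))"
    unfolding T_def
    by (rule smooth_on_differentiable[OF maximal_transition(2)[OF FC_max[OF c] FC_max[OF d(1)]] tr(3)])
  note lin = linear_D[OF Td]
  have w: "components (jc d) (tangent JA (jc c) j u) = D (\<lambda>z. snd (jc d) (chart_inv (jc c) z)) (t, x, y) u" for u
    using J.components_tangent_change[OF jc_in_JA[OF d(1)] jc_in_JA[OF c] d(3) j] z by simp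
  have y': "snd (jc d) j = (t, snd (T (t, x)), snd (D T (t, x) (1, y)))"
    using tr(1) by (simp add: T_def)
  let ?\<zeta> = "fst (snd u) - fst u *\<^sub>R y"
  \<comment> \<open>Subtracting the multiple of (1, y) with the same time component leaves (0,
    \<open>?\<zeta>\<close>), so linearity of \<open>D T\<close> gives the transformation law of
    \<delta>x.\<close>
  have \<zeta>: "D T (t, x) (0, ?\<zeta>) = D T (t, x) (fst u, fst (snd u)) - fst u *\<^sub>R D T (t, x) (1, y)"
    using linear_diff[OF lin, of "(fst u, fst (snd u))" "fst u *\<^sub>R (1, y)"] linear_scale[OF lin, of "fst u" "(1, y)"]
    by simp
  have "vertical_endo A \<pi> j (tangent JA (jc c) j u) =
      tangent JA (jc d) j (0, 0, snd (D T (t, x) (fst u, fst (snd u))) - fst u *\<^sub>R snd (D T (t, x) (1, y)))"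
    unfolding vertical_endo_def d(2) Let_def w y' using D\<Psi>(1,2)[of u]
    by (simp add: case_prod_unfold)
  also have "\<dots> = tangent JA (jc d) j (0, 0, snd (D T (t, x) (0, ?\<zeta>)))"
    by (simp add: \<zeta>)
  also have "\<dots> = tangent JA (jc c) j (0, 0, ?\<zeta>)"
    using J.tangent_change[OF jc_in_JA[OF d(1)] jc_in_JA[OF c] d(3) j, of "(0, 0, ?\<zeta>)"] z D\<Psi>(3) by simp
  finally show ?thesis by (simp add: z)
qed

lemma dt_tangent:
  assumes "c \<in> FC" "j \<in> fst (jc c)"
  shows "dt j (tangent JA (jc c) j u) = fst u"
proof -
  \<comment> \<open>An equality on all jets, also outside the chart domain, since every jet chart
    has \<open>fst\<close> as its first coordinate; no locality argument is needed.\<close>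
  have "(\<lambda>q. snd (jc c) q \<bullet> (1, 0, 0)) = fst"
    by (simp add: jet_chart_def fun_eq_iff)
  then show ?thesis
    using J.tangent_coordinate[OF jc_in_JA[OF assms(1)] assms(2), of u "(1, 0, 0)"]
    by (cases u) (simp add: dt_def differential_def)
qed

lemma pi10_jc_inv:
  assumes c: "c \<in> FC" and z: "z \<in> snd (jc c) ` fst (jc c)"
  shows "pi10 (chart_inv (jc c) z) = chart_inv c (fst z, fst (snd z))"
proof -
  obtain j where j: "j \<in> fst (jc c)" "z = snd (jc c) j" using z by blast
  obtain t x y where xy: "z = (t, x, y)" by (rule prod_cases3)
  obtain \<gamma> where \<gamma>: "pi10 j = \<gamma> t" "\<gamma> t \<in> fst c" "snd c (\<gamma> t) = (t, x)"
    by (rule jc_jetE[OF c j(1) j(2)[symmetric, unfolded xy]])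
  have "chart_inv (jc c) z = j"
    using J.inv_chart[OF jc_in_JA[OF c] j(1)] j(2) by simp
  then show ?thesis
    using M.inv_chart[OF FC_max[OF c] \<gamma>(2)] \<gamma>(1,3) xy by simp
qed

text \<open>From left to right, the pushed vector is tested on the coordinates of c, which read off
  the t- and x-components of u. Conversely, \<open>f \<circ> pi10\<close> depends on (t, x) only and
  is constant along lines in y-directions.\<close>

lemma vertical_tangent:
  assumes c: "c \<in> FC" and j: "j \<in> fst (jc c)"
  shows "vertical A j (tangent JA (jc c) j u) \<longleftrightarrow> fst u = 0 \<and> fst (snd u) = 0"
proof
  assume v: "vertical A j (tangent JA (jc c) j u)"
  have pc: "pi10 j \<in> fst c" using j by (simp add: fst_jc)
  have 0: "tangent JA (jc c) j u ((\<lambda>q. snd c q \<bullet> b) \<circ> pi10) = 0" for b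
    using fun_cong[OF v[unfolded vertical_def], of "\<lambda>q. snd c q \<bullet> b"]
      smooth_near_maximal_coordinate[OF FC_max[OF c] pc, of b]
    by (simp only: push_def if_True)
  have x_eq: "(\<lambda>q. snd c q \<bullet> (0, b)) \<circ> pi10 = (\<lambda>q. snd (jc c) q \<bullet> (0, b, 0))" for b
    by (rule ext) (simp add: jet_chart_def inner_prod_def)
  have "u \<bullet> (0, b, 0) = 0" for b
    using 0[of "(0, b)"] unfolding x_eq J.tangent_coordinate[OF jc_in_JA[OF c] j] .
  from this[of "fst (snd u)"] have x: "fst (snd u) = 0"
    by (simp add: inner_prod_def)
  \<comment> \<open>The time coordinate read through \<open>pi10\<close> is known to agree with that
    of the jet chart on the chart domain, so locality of tangent vectors is used instead of an
    equality of functions.\<close>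
  have eq: "snd (jc c) q \<bullet> (1, 0, 0) = ((\<lambda>q. snd c q \<bullet> (1, 0)) \<circ> pi10) q" if q: "q \<in> fst (jc c)" for q
  proof -
    obtain t x y where xy: "snd (jc c) q = (t, x, y)" by (rule prod_cases3)
    obtain \<gamma> where "pi10 q = \<gamma> t" "snd c (\<gamma> t) = (t, x)"
      by (rule jc_jetE[OF c q xy])
    then show ?thesis using xy by simp
  qed
  have sm: "smooth_fun JA (fst (jc c)) (\<lambda>q. snd (jc c) q \<bullet> (1, 0, 0))"
    by (rule J.smooth_fun_coordinate[OF jc_in_JA[OF c]])
  have "u \<bullet> (1, 0, 0) = tangent JA (jc c) j u ((\<lambda>q. snd c q \<bullet> (1, 0)) \<circ> pi10)"
    by (rule trans[OF J.tangent_coordinate[OF jc_in_JA[OF c] j, symmetric]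
          J.tangent_cong[OF sm J.opn_domain[OF jc_in_JA[OF c]] j eq jc_in_JA[OF c] j]])
  then have "u \<bullet> (1, 0, 0) = 0" unfolding 0 .
  then have "fst u = 0" by (simp add: inner_prod_def)
  with x show "fst u = 0 \<and> fst (snd u) = 0" by simp
next
  assume u: "fst u = 0 \<and> fst (snd u) = 0"
  have "tangent JA (jc c) j u (f \<circ> pi10) = 0" for f
  proof (cases "smooth_near JA j (f \<circ> pi10)")
    case True
    obtain V where V: "open V" "snd (jc c) j \<in> V" "V \<subseteq> snd (jc c) ` fst (jc c)"
      "smooth_on V (\<lambda>z. (f \<circ> pi10) (chart_inv (jc c) z))"
      by (rule J.smooth_near_chart[OF True jc_in_JA[OF c] j])
    let ?z = "snd (jc c) j" and ?g = "\<lambda>z. (f \<circ> pi10) (chart_inv (jc c) z)"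
    have A: "((\<lambda>s. ?g (?z + s *\<^sub>R u)) has_vector_derivative D ?g ?z u) (at 0)"
      by (rule has_vector_derivative_line_0[OF smooth_on_differentiable[OF V(4,2)]])
    have N: "open ((\<lambda>s. ?z + s *\<^sub>R u) -` V)" "0 \<in> (\<lambda>s. ?z + s *\<^sub>R u) -` V"
      using V(2) by (auto intro!: open_vimage[OF V(1)] continuous_intros)
    have "?g (?z + s *\<^sub>R u) = f (chart_inv c (fst ?z, fst (snd ?z)))" if "s \<in> (\<lambda>s. ?z + s *\<^sub>R u) -` V" for s
    proof -
      have "?z + s *\<^sub>R u \<in> snd (jc c) ` fst (jc c)" using that V(3) by blast
      from pi10_jc_inv[OF c this] show ?thesis using u by simp
    qed
    from has_vector_derivative_transform_within_open[OF A N this]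
    have "D ?g ?z u = 0"
      by (rule vector_derivative_unique_at[OF _ has_vector_derivative_const])
    then show ?thesis using J.tangent_smooth[OF True] by simp
  qed (simp add: tangent_def)
  then show "vertical A j (tangent JA (jc c) j u)"
    unfolding vertical_def push_def by (simp only: if_cancel)
qed

section \<open>Semi-basic forms and the Poincare-Cartan form in jet charts\<close>

lemma semi_basic_vertical:
  assumes "semi_basic A \<pi> W \<theta>" "c \<in> FC" "z \<in> snd (jc c) ` (W \<inter> fst (jc c))"
  shows "form_coeffs JA (jc c) \<theta> z \<bullet> (0, 0, \<eta>) = 0"
proof -
  obtain j where j: "j \<in> W" "j \<in> fst (jc c)" "z = snd (jc c) j" using assms(3) by blast
  have "\<theta> j (tangent JA (jc c) j (0, 0, \<eta>)) = 0"
    using assms(1) j(1) J.tangent_in_space[OF jc_in_JA[OF assms(2)] j(2)] vertical_tangent[OF assms(2) j(2)]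
    unfolding semi_basic_def by simp
  then show ?thesis
    using J.form_coeffs_inner[OF _ jc_in_JA[OF assms(2)] assms(3), of \<theta> "(0, 0, \<eta>)"] assms(1)
      J.form_at_tangent[OF jc_in_JA[OF assms(2)] j(2), of \<theta>] j(3)
    by (simp add: semi_basic_def)
qed

lemma poincare_cartan_tangent:
  assumes L: "smooth_fun JA W L" and W: "jet_open A \<pi> W" and c: "c \<in> FC" and j: "j \<in> W" "j \<in> fst (jc c)"
  shows "poincare_cartan A \<pi> L j (tangent JA (jc c) j u) =
    L j * fst u + D (\<lambda>z. L (chart_inv (jc c) z)) (snd (jc c) j)
      (0, 0, fst (snd u) - fst u *\<^sub>R snd (snd (snd (jc c) j)))"
  unfolding poincare_cartan_def differential_def
  by (simp add: dt_tangent[OF c j(2)] vertical_endo_tangent[OF c j(2)] J.tangent_smooth_fun[OF L W j(1)])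

lemma poincare_cartan_in_chart:
  assumes L: "smooth_fun JA W L" and W: "jet_open A \<pi> W" and c: "c \<in> FC" and z: "z \<in> snd (jc c) ` (W \<inter> fst (jc c))"
  shows "in_chart JA (jc c) (poincare_cartan A \<pi> L) z u =
    L (chart_inv (jc c) z) * fst u + D (\<lambda>z. L (chart_inv (jc c) z)) z (0, 0, fst (snd u) - fst u *\<^sub>R snd (snd z))"
proof -
  obtain j where j: "j \<in> W" "j \<in> fst (jc c)" "z = snd (jc c) j" using z by blast
  show ?thesis
    using poincare_cartan_tangent[OF L W c j(1,2)] J.inv_chart[OF jc_in_JA[OF c] j(2)] j(3)
    by (simp add: in_chart_def)
qed

lemma one_form_poincare_cartan:
  assumes L: "smooth_fun JA W L" and W: "jet_open A \<pi> W"
  shows "one_form JA W (poincare_cartan A \<pi> L)"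
  unfolding one_form_def
proof (intro ballI conjI allI)
  fix c' assume "c' \<in> JA"
  then obtain c where c: "c \<in> FC" "c' = jc c" by (rule JA_E)
  let ?U = "snd c' ` (W \<inter> fst c')" and ?f = "\<lambda>z. L (chart_inv c' z)"
  have U: "open ?U" and f: "smooth_on ?U ?f"
    using J.open_chart_image[OF W \<open>c' \<in> JA\<close>] J.smooth_funD[OF L \<open>c' \<in> JA\<close>] by auto
  note eq = poincare_cartan_in_chart[OF L W c(1), folded c(2)]
  show "linear (in_chart JA c' (poincare_cartan A \<pi> L) z)" if z: "z \<in> ?U" for z
  proof -
    define P where "P u = (0 :: real, 0 :: real ^ 'n, fst (snd u) - fst u *\<^sub>R snd (snd z))"
      for u :: "real \<times> (real ^ 'n) \<times> (real ^ 'n)"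
    have "linear P" unfolding P_def by (auto intro!: linearI simp: algebra_simps)
    from linear_compose[OF this linear_D[OF smooth_on_differentiable[OF f z]]]
    have "linear (\<lambda>u. D ?f z (P u))" by (simp add: o_def)
    moreover have "linear (\<lambda>u :: real \<times> (real ^ 'n) \<times> (real ^ 'n). ?f z * fst u)"
      by (auto intro!: linearI simp: algebra_simps)
    ultimately show ?thesis
      unfolding eq[OF z, abs_def] P_def[symmetric] by (rule linear_compose_add[rotated])
  qed
  show "smooth_on ?U (\<lambda>z. in_chart JA c' (poincare_cartan A \<pi> L) z u)" for u
  proof (rule smooth_on_cong[OF _ U])
    show "smooth_on ?U (\<lambda>z. ?f z * fst u + D ?f z (0, 0, fst (snd u) - fst u *\<^sub>R snd (snd z)))"
      by (intro smooth_on_add smooth_on_mult smooth_on_D_apply smooth_on_Pair smooth_on_diff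
          smooth_on_scaleR smooth_on_snd smooth_on_const smooth_on_ident U f)
  qed (simp add: eq)
qed

lemma semi_basic_poincare_cartan:
  assumes L: "smooth_fun JA W L" and W: "jet_open A \<pi> W"
  shows "semi_basic A \<pi> W (poincare_cartan A \<pi> L)"
  unfolding semi_basic_def
proof (intro conjI ballI impI)
  show "one_form JA W (poincare_cartan A \<pi> L)" by (rule one_form_poincare_cartan[OF L W])
  fix j v assume j: "j \<in> W" and v: "v \<in> tangent_space JA j" "vertical A j v"
  obtain c where c: "c \<in> FC" "j \<in> fst (jc c)"
    using points_JA_E J.opn_subset_points[OF W] j by blast
  define u where "u = components (jc c) v"
  have vu: "v = tangent JA (jc c) j u"
    unfolding u_def by (rule J.tangent_space_eq[OF jc_in_JA[OF c(1)] c(2) v(1)])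
  have "fst u = 0" "fst (snd u) = 0"
    using v(2) vertical_tangent[OF c] unfolding vu by auto
  moreover have "(\<lambda>z. L (chart_inv (jc c) z)) differentiable (at (snd (jc c) j))"
    by (rule smooth_on_differentiable[OF J.smooth_funD[OF L jc_in_JA[OF c(1)]]]) (use j c in blast)
  ultimately show "poincare_cartan A \<pi> L j v = 0"
    unfolding vu poincare_cartan_tangent[OF L W c(1) j c(2)]
    using linear_0[OF linear_D] by (simp add: zero_prod_def[symmetric])
qed

end

section \<open>Semisprays in jet coordinates\<close>

locale semispray_jets = jets A \<pi> for A :: "('m, real \<times> (real ^ 'n)) atlas" and \<pi> +
  fixes S :: "'m jet \<Rightarrow> 'm jet tvec"
  assumes spray: "semispray A \<pi> S"
begin

lemma points_JA: "points JA = J1 A \<pi>"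
proof
  show "J1 A \<pi> \<subseteq> points JA"
    using spray unfolding semispray_def vector_field_def tangent_space_def points_def by blast
qed (rule points_JA_subset)

lemma opn_J1: "jet_open A \<pi> (J1 A \<pi>)"
  using J.opn_points by (simp add: points_JA)

lemma spray_field: "jet_open A \<pi> W \<Longrightarrow> vector_field JA W S"
  using spray J.vector_field_subset J.opn_subset_points unfolding semispray_def points_JA by metis

lemma spray_coeffs:
  assumes c: "c \<in> FC" and z: "z \<in> snd (jc c) ` fst (jc c)"
  shows "fst (field_coeffs (jc c) S z) = 1" "fst (snd (field_coeffs (jc c) S z)) = snd (snd z)"
proof -
  obtain j where j: "j \<in> fst (jc c)" "z = snd (jc c) j" using z by blast
  have J: "j \<in> J1 A \<pi>" using j by (simp add: fst_jc)
  let ?\<sigma> = "field_coeffs (jc c) S z"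
  have S: "S j = tangent JA (jc c) j ?\<sigma>"
    using J.field_coeffs_tangent[OF spray_field[OF opn_J1] jc_in_JA[OF c] J j(1)] j(2) by simp
  have "dt j (S j) = 1" and v: "vertical_endo A \<pi> j (S j) = (\<lambda>f. 0)"
    using spray J unfolding semispray_def by auto
  then show 1: "fst ?\<sigma> = 1" using dt_tangent[OF c j(1)] S by simp
  have "components (jc c) (vertical_endo A \<pi> j (S j)) = 0"
    unfolding v by (simp add: components_def)
  then have "fst (snd ?\<sigma>) - fst ?\<sigma> *\<^sub>R snd (snd z) = 0"
    unfolding S vertical_endo_tangent[OF c j(1)] J.components_tangent[OF jc_in_JA[OF c] j(1)] j(2)[symmetric]
    by (simp add: prod_eq_iff)
  then show "fst (snd ?\<sigma>) = snd (snd z)" using 1 by simp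
qed

end

section \<open>Lagrangians of a semispray\<close>

context semispray_jets
begin

text \<open>As dt(S) = 1 and J(S) = 0, the value \<theta>(S) is L. So d(\<theta>(S)) in Cartan's
  formula is dL, and the Euler-Lagrange equation leaves i_S d\<theta> = 0; the correction term in
  \<open>nondegenerate\<close> disappears.\<close>

lemma poincare_cartan_solves:
  assumes W: "jet_open A \<pi> W" and reg: "regular_lagrangian A \<pi> W L" and el: "euler_lagrange_on A \<pi> S W L"
  defines "\<theta> \<equiv> poincare_cartan A \<pi> L"
  shows "semi_basic A \<pi> W \<theta>" "nondegenerate A \<pi> S W \<theta>" "closed_form JA W (lie_deriv JA S \<theta>)"
proof -
  have L: "smooth_fun JA W L" using reg by (simp add: regular_lagrangian_def)
  show "semi_basic A \<pi> W \<theta>" unfolding \<theta>_def by (rule semi_basic_poincare_cartan[OF L W])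
  have \<theta>: "one_form JA W \<theta>" unfolding \<theta>_def by (rule one_form_poincare_cartan[OF L W])
  have SF: "vector_field JA W S" by (rule spray_field[OF W])
  have iS: "interior1 S \<theta> p = L p" if p: "p \<in> W" for p
  proof -
    obtain c where c: "c \<in> FC" "p \<in> fst (jc c)"
      using points_JA_E J.opn_subset_points[OF W] p by blast
    let ?z = "snd (jc c) p"
    have z: "?z \<in> snd (jc c) ` fst (jc c)" using c(2) by blast
    have d: "(\<lambda>z. L (chart_inv (jc c) z)) differentiable (at ?z)"
      by (rule smooth_on_differentiable[OF J.smooth_funD[OF L jc_in_JA[OF c(1)]]]) (use p c in blast)
    show ?thesis
      unfolding interior1_def J.field_coeffs_tangent[OF SF jc_in_JA[OF c(1)] p c(2)] \<theta>_def
        poincare_cartan_tangent[OF L W c(1) p c(2)]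
      using spray_coeffs[OF c(1) z] linear_0[OF linear_D[OF d]] by (simp add: zero_prod_def[symmetric])
  qed
  \<comment> \<open>The two functions agree on W, so their differentials are compared by
    locality.\<close>
  have dL: "differential (interior1 S \<theta>) p v = differential L p v"
    if p: "p \<in> W" and v: "v \<in> tangent_space JA p" for p v
  proof -
    obtain c where c: "c \<in> FC" "p \<in> fst (jc c)"
      using points_JA_E J.opn_subset_points[OF W] p by blast
    define u where "u = components (jc c) v"
    have vu: "v = tangent JA (jc c) p u"
      unfolding u_def by (rule J.tangent_space_eq[OF jc_in_JA[OF c(1)] c(2) v])
    show ?thesis
      unfolding differential_def vu
      by (rule J.tangent_cong[OF J.smooth_interior1[OF \<theta> SF W] W p iS jc_in_JA[OF c(1)] c(2)])
  qed
  have i0: "interior2 S (ext_deriv JA \<theta>) p v = 0" if "p \<in> W" "v \<in> tangent_space JA p" for p v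
  proof -
    have "lie_deriv JA S \<theta> p v = differential L p v"
      using el that unfolding euler_lagrange_on_def \<theta>_def by blast
    then show ?thesis using dL[OF that] by (simp add: lie_deriv_def)
  qed
  show "nondegenerate A \<pi> S W \<theta>"
    unfolding nondegenerate_def Let_def
  proof
    fix j assume j: "j \<in> W"
    have "rank2 JA j (\<lambda>p v w. ext_deriv JA \<theta> p v w + wedge (interior2 S (ext_deriv JA \<theta>)) dt p v w)
        = rank2 JA j (ext_deriv JA \<theta>)"
      using J.opn_subset_points[OF W] j by (intro J.rank2_cong) (auto simp: wedge_def i0[OF j])
    then show "rank2 JA j (\<lambda>p v w. ext_deriv JA \<theta> p v w + wedge (interior2 S (ext_deriv JA \<theta>)) dt p v w)
        = 2 * CARD('n)"
      using reg j by (simp add: regular_lagrangian_def \<theta>_def)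
  qed
  show "closed_form JA W (lie_deriv JA S \<theta>)"
    unfolding closed_form_def
  proof (intro ballI)
    fix p v w assume p: "p \<in> W" and v: "v \<in> tangent_space JA p" and w: "w \<in> tangent_space JA p"
    obtain c where c: "c \<in> FC" "p \<in> fst (jc c)"
      using points_JA_E J.opn_subset_points[OF W] p by blast
    note c' = jc_in_JA[OF c(1)]
    let ?\<alpha> = "lie_deriv JA S \<theta>" and ?U = "snd (jc c) ` (W \<inter> fst (jc c))"
    let ?f = "\<lambda>z. L (chart_inv (jc c) z)" and ?z = "snd (jc c) p"
    have \<alpha>: "one_form JA W ?\<alpha>" by (rule J.one_form_lie_deriv[OF \<theta> SF W])
    have U: "open ?U" "?z \<in> ?U" using J.open_chart_image[OF W c'] p c(2) by auto
    have fs: "smooth_on ?U ?f" by (rule J.smooth_funD[OF L c'])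
    have eq: "in_chart JA (jc c) ?\<alpha> z u = D ?f z u" if "z \<in> ?U" for z u
    proof -
      obtain q where q: "q \<in> W" "q \<in> fst (jc c)" "z = snd (jc c) q" using \<open>z \<in> ?U\<close> by blast
      have "?\<alpha> q (tangent JA (jc c) q u) = differential L q (tangent JA (jc c) q u)"
        using el q(1) J.tangent_in_space[OF c' q(2)] unfolding euler_lagrange_on_def \<theta>_def by blast
      then show ?thesis
        unfolding J.form_at_tangent[OF c' q(2)] differential_def J.tangent_smooth_fun[OF L W q(1)] q(3) .
    qed
    \<comment> \<open>The Lie derivative has the coefficients of dL on all of \<open>?U\<close>, so
      its closedness is d(dL) = 0, the symmetry of second derivatives.\<close>
    have Dd: "D (form_coeffs JA (jc c) ?\<alpha>) ?z u \<bullet> u' = D (\<lambda>z. D ?f z u') ?z u" for u u'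
    proof -
      have "D (\<lambda>z. D ?f z u') ?z = D (\<lambda>z. in_chart JA (jc c) ?\<alpha> z u') ?z"
        by (rule D_cong[OF U]) (auto simp: eq intro: smooth_on_differentiable[OF smooth_on_D[OF fs] U(2)])
      then show ?thesis
        using J.form_coeffs_D[OF \<alpha> c' W U(2), of u' u] by simp
    qed
    have "ext_deriv JA ?\<alpha> p (tangent JA (jc c) p u) (tangent JA (jc c) p u') = 0" for u u'
      unfolding J.ext_deriv_chart[OF \<alpha> W c' p c(2)] Dd
      using second_derivative_symmetric_real[OF U(1) fs U(2), of u u'] by simp
    then show "ext_deriv JA ?\<alpha> p v w = 0"
      by (subst J.tangent_space_eq[OF c' c(2) v], subst J.tangent_space_eq[OF c' c(2) w])
  qed
qed

text \<open>The potential exists on a small set V in the chart \<open>k\<close>, so L lives on a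
  smaller neighbourhood W' of j. In this chart \<open>a\<close>, \<open>\<sigma>\<close> and
  \<open>f\<close> represent \<theta>, S and L, and \<open>e\<close> represents dt.\<close>

lemma potential_lagrangian:
  assumes W: "jet_open A \<pi> W" and sb: "semi_basic A \<pi> W \<theta>" and nd: "nondegenerate A \<pi> S W \<theta>"
    and cl: "closed_form JA W (lie_deriv JA S \<theta>)" and j: "j \<in> W"
  shows "\<exists>W' L. jet_open A \<pi> W' \<and> j \<in> W' \<and> regular_lagrangian A \<pi> W' L \<and> euler_lagrange_on A \<pi> S W' L"
proof -
  have \<theta>: "one_form JA W \<theta>" using sb by (simp add: semi_basic_def)
  have SF: "vector_field JA W S" by (rule spray_field[OF W])
  obtain c where c: "c \<in> FC" "j \<in> fst (jc c)"
    using points_JA_E J.opn_subset_points[OF W] j by blast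
  note c' = jc_in_JA[OF c(1)]
  define k where "k = jc c"
  have kA: "k \<in> JA" unfolding k_def by (rule c')
  have kj: "j \<in> fst k" using c(2) by (simp add: k_def)
  let ?\<alpha> = "lie_deriv JA S \<theta>"
  have \<alpha>: "one_form JA W ?\<alpha>" by (rule J.one_form_lie_deriv[OF \<theta> SF W])
  obtain V and f :: "real \<times> (real ^ 'n) \<times> (real ^ 'n) \<Rightarrow> real"
    where V: "open V" "snd k j \<in> V" "V \<subseteq> snd k ` (W \<inter> fst k)" "smooth_on V f"
      and Df0: "\<forall>z\<in>V. \<forall>u. D f z u = form_coeffs JA k ?\<alpha> z \<bullet> u"
    by (rule J.local_potential[OF \<alpha> W cl kA j kj])
  define W' where "W' = fst k \<inter> snd k -` V"
  define L where "L q = f (snd k q)" for q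
  have VU: "V \<subseteq> snd k ` fst k" using V(3) by blast
  have W': "jet_open A \<pi> W'" unfolding W'_def by (rule J.opn_chart_preimage[OF kA V(1)])
  have W'W: "W' \<subseteq> W"
  proof
    fix q assume "q \<in> W'"
    then have q: "q \<in> fst k" "snd k q \<in> V" by (auto simp: W'_def)
    then obtain r where "r \<in> W" "r \<in> fst k" "snd k q = snd k r" using V(3) by blast
    then show "q \<in> W" using chart_eqD[OF _ J.charts[OF kA]] q(1) by blast
  qed
  have im: "snd k ` (W' \<inter> fst k) = V" using VU by (auto simp: W'_def)
  have Lf: "L (chart_inv k z) = f z" if "z \<in> V" for z
    unfolding L_def using chart_of_inv[of z k "fst k"] that VU by auto
  have Ls: "smooth_fun JA W' L"
    unfolding W'_def
    by (rule J.smooth_funI_chart[OF kA V(1) VU smooth_on_cong[OF V(4,1)]]) (simp add: Lf)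
  have fd: "f differentiable (at z)" if "z \<in> V" for z
    by (rule smooth_on_differentiable[OF V(4) that])
  have DL: "D (\<lambda>z. L (chart_inv k z)) z = D f z" if "z \<in> V" for z
    by (rule D_cong[OF V(1) that, symmetric]) (auto simp: Lf fd that)
  define a where "a = form_coeffs JA k \<theta>"
  define \<sigma> where "\<sigma> = field_coeffs k S"
  have as: "smooth_on V a" unfolding a_def by (rule smooth_on_subset[OF J.form_coeffs_smooth[OF \<theta> kA W] V(3)])
  have \<sigma>s: "smooth_on V \<sigma>" unfolding \<sigma>_def by (rule smooth_on_subset[OF J.field_coeffs_smooth[OF SF kA] V(3)])
  note ad = smooth_on_differentiable[OF as] and \<sigma>d = smooth_on_differentiable[OF \<sigma>s]
  have Df: "D f z u = D a z (\<sigma> z) \<bullet> u + a z \<bullet> D \<sigma> z u" if z: "z \<in> V" for z u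
  proof -
    have zU: "z \<in> snd k ` (W \<inter> fst k)" using z V(3) by blast
    then obtain q where q: "q \<in> W" "q \<in> fst k" "z = snd k q" by blast
    have "D f z u = in_chart JA k ?\<alpha> z u"
      unfolding J.form_coeffs_inner[OF \<alpha> kA zU] using Df0 z by blast
    also have "\<dots> = ?\<alpha> q (tangent JA k q u)"
      using J.form_at_tangent[OF kA q(2)] q(3) by simp
    finally show ?thesis
      using J.lie_deriv_chart(3)[OF \<theta> SF W kA q(1,2), of u] q(3) by (simp add: a_def \<sigma>_def)
  qed
  have a0: "a z \<bullet> (0, 0, \<eta>) = 0" if "z \<in> V" for z \<eta>
    unfolding a_def k_def by (rule semi_basic_vertical[OF sb c(1)]) (use that V(3) in \<open>auto simp: k_def\<close>)
  \<comment> \<open>The vanishing of \<theta> on vertical vectors is an identity on the open set V,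
    so it can be differentiated in any direction.\<close>
  have Da0: "D a z v \<bullet> (0, 0, \<eta>) = 0" if z: "z \<in> V" for z v \<eta>
  proof -
    have "D (\<lambda>z. a z \<bullet> (0, 0, \<eta>)) z = D (\<lambda>z. 0) z"
      by (rule D_cong[OF V(1) z]) (auto simp: a0 intro: differentiable_bounded_linear[OF bounded_linear_inner_left] ad[OF z])
    then show ?thesis
      using D_compose_linear[OF bounded_linear_inner_left ad[OF z], of "(0, 0, \<eta>)" v] by simp
  qed
  have \<sigma>1: "fst (\<sigma> z) = 1" "fst (snd (\<sigma> z)) = snd (snd z)" if "z \<in> V" for z
    using spray_coeffs[OF c(1), of z] that VU by (auto simp: \<sigma>_def k_def)
  have fs: "bounded_linear (\<lambda>z :: real \<times> (real ^ 'n) \<times> (real ^ 'n). fst (snd z))"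
    "bounded_linear (\<lambda>z :: real \<times> (real ^ 'n) \<times> (real ^ 'n). snd (snd z))"
    by (intro bounded_linear_compose[OF bounded_linear_fst] bounded_linear_compose[OF bounded_linear_snd]
        bounded_linear_snd)+
  \<comment> \<open>The semispray conditions differentiated: the time component of
    \<open>\<sigma>\<close> is constantly 1 and its x-component is the coordinate y.\<close>
  have D\<sigma>1: "fst (D \<sigma> z u) = 0" and D\<sigma>2: "fst (snd (D \<sigma> z u)) = snd (snd u)" if z: "z \<in> V" for z u
  proof -
    have "D (\<lambda>z. fst (\<sigma> z)) z = D (\<lambda>z. 1) z"
      by (rule D_cong[OF V(1) z]) (auto simp: \<sigma>1 intro: differentiable_bounded_linear[OF bounded_linear_fst] \<sigma>d[OF z])
    then show "fst (D \<sigma> z u) = 0"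
      using D_compose_linear[OF bounded_linear_fst \<sigma>d[OF z], of u] by simp
    have "D (\<lambda>z. fst (snd (\<sigma> z))) z = D (\<lambda>z. snd (snd z)) z"
      by (rule D_cong[OF V(1) z]) (auto simp: \<sigma>1 intro: differentiable_bounded_linear[OF fs(1)] \<sigma>d[OF z])
    then show "fst (snd (D \<sigma> z u)) = snd (snd u)"
      using D_compose_linear[OF fs(1) \<sigma>d[OF z], of u]
        D_eqI[OF bounded_linear_imp_has_derivative[OF fs(2)], of z] by simp
  qed
  have a_split: "a z \<bullet> u = a z \<bullet> (fst u, fst (snd u), 0)" if "z \<in> V" for z u
    using inner_add_right[of "a z" "(fst u, fst (snd u), 0)" "(0, 0, snd (snd u))"] a0[OF that]
    by (simp add: prod_eq_iff[of u] plus_prod_def)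
  \<comment> \<open>By \<open>a0\<close> only the (t, x)-part of
    \<open>D \<sigma> z (0, 0, \<eta>)\<close> matters, and it is (0, \<eta>).\<close>
  have Df_vert: "D f z (0, 0, \<eta>) = a z \<bullet> (0, \<eta>, 0)" if z: "z \<in> V" for z \<eta>
    unfolding Df[OF z] Da0[OF z] using a_split[OF z, of "D \<sigma> z (0, 0, \<eta>)"] D\<sigma>1[OF z] D\<sigma>2[OF z] by simp
  define g where "g z = a z \<bullet> \<sigma> z - f z" for z
  define e where "e = (1 :: real, 0 :: real ^ 'n, 0 :: real ^ 'n)"
  have e_inner: "e \<bullet> u = fst u" "u \<bullet> e = fst u" for u by (simp_all add: e_def inner_prod_def)
  have agd: "(\<lambda>z. a z \<bullet> \<sigma> z) differentiable (at z)" if "z \<in> V" for z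
    by (rule differentiable_bilinear[OF bounded_bilinear_inner ad[OF that] \<sigma>d[OF that]])
  have gd: "g differentiable (at z)" if "z \<in> V" for z
    unfolding g_def by (rule differentiable_diff[OF agd[OF that] fd[OF that]])
  \<comment> \<open>The terms with \<open>D \<sigma>\<close> cancel because \<open>f\<close> is a
    potential of the Lie derivative; what remains is - i_S d\<theta> in coordinates. It vanishes at
    v = \<open>\<sigma> z\<close>, which is S(g) = 0.\<close>
  have Dg: "D g z v = D a z v \<bullet> \<sigma> z - D a z (\<sigma> z) \<bullet> v" if z: "z \<in> V" for z v
    unfolding g_def D_diff[OF agd[OF z] fd[OF z]] D_inner[OF ad[OF z] \<sigma>d[OF z]] Df[OF z] by simp
  let ?PC = "poincare_cartan A \<pi> L"
  have PC: "one_form JA W' ?PC" by (rule one_form_poincare_cartan[OF Ls W'])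
  have b: "form_coeffs JA k ?PC z = a z - g z *\<^sub>R e" if z: "z \<in> V" for z
  proof (rule J.form_coeffs_unique)
    fix u :: "real \<times> (real ^ 'n) \<times> (real ^ 'n)"
    let ?\<zeta> = "fst (snd u) - fst u *\<^sub>R snd (snd z)"
    have "in_chart JA k ?PC z u = f z * fst u + a z \<bullet> (0, ?\<zeta>, 0)"
      using poincare_cartan_in_chart[OF Ls W' c(1), of z u, folded k_def] z im
      by (simp add: Lf DL Df_vert)
    \<comment> \<open>The (t, x)-part of u minus a multiple of that of S, by the semispray
      conditions; applying \<open>a\<close> gives \<theta> - \<theta>(S) dt.\<close>
    also have "(0, ?\<zeta>, 0) = (fst u, fst (snd u), 0) - fst u *\<^sub>R (fst (\<sigma> z), fst (snd (\<sigma> z)), 0)"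
      using \<sigma>1[OF z] by simp
    also have "a z \<bullet> \<dots> = a z \<bullet> u - fst u * (a z \<bullet> \<sigma> z)"
      by (simp only: inner_diff_right inner_scaleR_right a_split[OF z, symmetric])
    finally show "in_chart JA k ?PC z u = (a z - g z *\<^sub>R e) \<bullet> u"
      by (simp add: g_def inner_diff_left e_inner algebra_simps)
  qed
  have Db: "D (form_coeffs JA k ?PC) z v = D a z v - D g z v *\<^sub>R e" if z: "z \<in> V" for z v
  proof -
    have ged: "(\<lambda>z. g z *\<^sub>R e) differentiable (at z)"
      by (rule differentiable_bounded_linear[OF bounded_linear_scaleR_left gd[OF z]])
    have "D (\<lambda>z. a z - g z *\<^sub>R e) z = D (form_coeffs JA k ?PC) z"
      by (rule D_cong[OF V(1) z]) (simp_all add: b differentiable_diff[OF ad[OF z] ged])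
    then show ?thesis
      using D_diff[OF ad[OF z] ged, of v] D_compose_linear[OF bounded_linear_scaleR_left gd[OF z], of e v] by simp
  qed
  have S_tan: "S p = tangent JA k p (\<sigma> (snd k p))" if "p \<in> W'" for p
    unfolding \<sigma>_def by (rule J.field_coeffs_tangent[OF SF kA]) (use that W'W in \<open>auto simp: W'_def\<close>)
  have "euler_lagrange_on A \<pi> S W' L"
    unfolding euler_lagrange_on_def
  proof (intro ballI)
    fix p v assume p: "p \<in> W'" and v: "v \<in> tangent_space JA p"
    have pk: "p \<in> fst k" and z: "snd k p \<in> V" using p by (auto simp: W'_def)
    define u where "u = components k v"
    have vu: "v = tangent JA k p u" unfolding u_def by (rule J.tangent_space_eq[OF kA pk v])
    \<comment> \<open>Compared with the Lie derivative of \<theta> there are two extra terms: S(g)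
      dt, zero by \<open>Dg\<close>, and g times the differential of dt(S), zero by
      \<open>D\<sigma>1\<close>.\<close>
    have "lie_deriv JA S ?PC p v = D f (snd k p) u"
      unfolding vu J.lie_deriv_chart(3)[OF PC spray_field[OF W'] W' kA p pk] \<sigma>_def[symmetric] Db[OF z] b[OF z]
      by (simp add: inner_diff_left e_inner Dg[OF z] D\<sigma>1[OF z] Df[OF z])
    moreover have "differential L p v = D f (snd k p) u"
      unfolding vu differential_def J.tangent_smooth_fun[OF Ls W' p] DL[OF z] ..
    ultimately show "lie_deriv JA S ?PC p v = differential L p v" by simp
  qed
  moreover have "regular_lagrangian A \<pi> W' L"
    unfolding regular_lagrangian_def
  proof (intro conjI ballI Ls)
    fix p assume p: "p \<in> W'"
    have pk: "p \<in> fst k" and z: "snd k p \<in> V" and pW: "p \<in> W" using p W'W by (auto simp: W'_def)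
    let ?\<omega> = "\<lambda>p v w. ext_deriv JA \<theta> p v w + wedge (interior2 S (ext_deriv JA \<theta>)) dt p v w"
    \<comment> \<open>This is d(\<theta> - g dt) = d\<theta> - dg \<and> dt with - dg replaced by
      i_S d\<theta>; it turns nondegeneracy of \<theta> into regularity of L.\<close>
    have "ext_deriv JA ?PC p v w = ?\<omega> p v w"
      if v: "v \<in> tangent_space JA p" and w: "w \<in> tangent_space JA p" for v w
    proof -
      define u where "u = components k v"
      have vu: "v = tangent JA k p u" unfolding u_def by (rule J.tangent_space_eq[OF kA pk v])
      define u' where "u' = components k w"
      have wu: "w = tangent JA k p u'" unfolding u'_def by (rule J.tangent_space_eq[OF kA pk w])
      have iS: "interior2 S (ext_deriv JA \<theta>) p (tangent JA k p x) = - D g (snd k p) x" for x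
        unfolding interior2_def S_tan[OF p] J.ext_deriv_chart[OF \<theta> W kA pW pk] Dg[OF z] a_def by simp
      have dt: "dt p (tangent JA k p x) = fst x" for x
        unfolding k_def by (rule dt_tangent[OF c(1)]) (use pk in \<open>simp add: k_def\<close>)
      show ?thesis
        unfolding vu wu wedge_def iS dt J.ext_deriv_chart[OF \<theta> W kA pW pk]
          J.ext_deriv_chart[OF PC W' kA p pk] Db[OF z] a_def[symmetric]
        by (simp add: inner_diff_left e_inner)
    qed
    then have "rank2 JA p (ext_deriv JA ?PC) = rank2 JA p ?\<omega>"
      by (intro J.rank2_cong J.chart_pointsI[OF kA pk])
    also have "\<dots> = 2 * CARD('n)"
      using nd pW unfolding nondegenerate_def Let_def by blast
    finally show "rank2 JA p (ext_deriv JA ?PC) = 2 * CARD('n)" .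
  qed
  moreover have "j \<in> W'" using V(2) kj by (simp add: W'_def)
  ultimately show ?thesis using W' by blast
qed

end

text \<open>Lagrangians near different points need not agree on overlaps, nor need their
  Poincare-Cartan forms, so the equivalence is stated with forms near each point. The other
  conjuncts keep track of domains: a form on the whole jet bundle yields local Lagrangians
  everywhere, and a Lagrangian on an open W, possibly the whole bundle, yields a form on the same
  W.\<close>

theorem theorem4p5:
  fixes A :: "('m, real \<times> (real ^ 'n)) atlas"
    and \<pi> :: "'m \<Rightarrow> real"
    and S :: "'m jet \<Rightarrow> 'm jet tvec"
  assumes "fibred_manifold A \<pi>"
    and "semispray A \<pi> S"
  shows "(lagrangian_vector_field A \<pi> S \<longleftrightarrow>
           (\<forall>j \<in> J1 A \<pi>. \<exists>W \<theta>. jet_open A \<pi> W \<and> j \<in> W \<and>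
              semi_basic A \<pi> W \<theta> \<and> nondegenerate A \<pi> S W \<theta> \<and>
              closed_form (jet_atlas A \<pi>) W (lie_deriv (jet_atlas A \<pi>) S \<theta>)))
       \<and> ((\<exists>\<theta>. semi_basic A \<pi> (J1 A \<pi>) \<theta> \<and> nondegenerate A \<pi> S (J1 A \<pi>) \<theta> \<and>
              closed_form (jet_atlas A \<pi>) (J1 A \<pi>) (lie_deriv (jet_atlas A \<pi>) S \<theta>))
           \<longrightarrow> lagrangian_vector_field A \<pi> S)
       \<and> (\<forall>W. jet_open A \<pi> W \<and>
            (\<exists>L. regular_lagrangian A \<pi> W L \<and> euler_lagrange_on A \<pi> S W L)
           \<longrightarrow> (\<exists>\<theta>. semi_basic A \<pi> W \<theta> \<and> nondegenerate A \<pi> S W \<theta> \<and>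
              closed_form (jet_atlas A \<pi>) W (lie_deriv (jet_atlas A \<pi>) S \<theta>)))"
proof -
  interpret semispray_jets A \<pi> S
    using assms by unfold_locales
  show ?thesis
  proof (intro conjI iffI)
    assume L: "lagrangian_vector_field A \<pi> S"
    show "\<forall>j \<in> J1 A \<pi>. \<exists>W \<theta>. jet_open A \<pi> W \<and> j \<in> W \<and> semi_basic A \<pi> W \<theta> \<and>
        nondegenerate A \<pi> S W \<theta> \<and> closed_form JA W (lie_deriv JA S \<theta>)"
      using L poincare_cartan_solves unfolding lagrangian_vector_field_def by meson
  next
    assume "\<forall>j \<in> J1 A \<pi>. \<exists>W \<theta>. jet_open A \<pi> W \<and> j \<in> W \<and> semi_basic A \<pi> W \<theta> \<and>
        nondegenerate A \<pi> S W \<theta> \<and> closed_form JA W (lie_deriv JA S \<theta>)"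
    then show "lagrangian_vector_field A \<pi> S"
      using potential_lagrangian unfolding lagrangian_vector_field_def by meson
  next
    show "(\<exists>\<theta>. semi_basic A \<pi> (J1 A \<pi>) \<theta> \<and> nondegenerate A \<pi> S (J1 A \<pi>) \<theta> \<and>
        closed_form JA (J1 A \<pi>) (lie_deriv JA S \<theta>)) \<longrightarrow> lagrangian_vector_field A \<pi> S"
      using potential_lagrangian[OF opn_J1] unfolding lagrangian_vector_field_def by blast
  next
    show "\<forall>W. jet_open A \<pi> W \<and> (\<exists>L. regular_lagrangian A \<pi> W L \<and> euler_lagrange_on A \<pi> S W L) \<longrightarrow>
        (\<exists>\<theta>. semi_basic A \<pi> W \<theta> \<and> nondegenerate A \<pi> S W \<theta> \<and> closed_form JA W (lie_deriv JA S \<theta>))"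
      using poincare_cartan_solves by blast
  qed
qed

end
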